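(* Let $N\ge 2$ and let $a,b$ be positive integers with $b>a$, $N\le b-a+1$, and $b/a\in\Psi_N$. Let $V\subset S_{b-a}$ be a general linear subspace of dimension $N$. Then for every nonzero linear subspace $W\subset S_{a-1}$ we have $\mu_V(W)\ge b/a$.
   Context: Over $\mathbb{C}$, fix an affine coordinate $u$ on $\mathbb{P}^1$; $S_a=H^0(\mathcal{O}_{\mathbb{P}^1}(a))$ is identified with polynomials in $u$ of degree at most $a$ (and $S_{-1}=0$). For subspaces $V,W$, $V\cdot W$ is the span of products $fg$ ($f\in V$, $g\in W$); for $V\subset S_{b-a}$ and nonzero $W\subset S_{a-1}$, the filling ratio is $\mu_V(W)=\dim(V\cdot W)/\dim W$. Define $\theta(x)=N-x^{-1}$ with the convention $\theta(\infty)=N$, $\psi_N=\lim_{i\to\infty}\theta^i(\infty)=\frac{N+\sqrt{N^2-4}}{2}$, and $\Psi_N=\{\alpha\in\mathbb{Q}:1<\alpha<\psi_N\}\cup\{\theta^i(\infty):i\ge 0\}\subset\mathbb{Q}\cup\{\infty\}$. "General" means in a nonempty Zariski-open subset of the Grassmannian. *)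

theory Defs
  imports "HOL-Analysis.Analysis" "HOL-Computational_Algebra.Polynomial"
begin

lemma vector_space_smult_poly: "vector_space (smult :: complex \<Rightarrow> complex poly \<Rightarrow> complex poly)"
  by unfold_locales (auto simp: smult_add_right smult_add_left)

abbreviation pspan :: "complex poly set \<Rightarrow> complex poly set" where
  "pspan \<equiv> module.span (smult :: complex \<Rightarrow> complex poly \<Rightarrow> complex poly)"

abbreviation psubspace :: "complex poly set \<Rightarrow> bool" where
  "psubspace \<equiv> module.subspace (smult :: complex \<Rightarrow> complex poly \<Rightarrow> complex poly)"

abbreviation pdim :: "complex poly set \<Rightarrow> nat" where
  "pdim \<equiv> vector_space.dim (smult :: complex \<Rightarrow> complex poly \<Rightarrow> complex poly)"

text \<open>S_a = H^0(O(a)) = polynomials of degree at most a (a >= 0).\<close>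
definition S :: "nat \<Rightarrow> complex poly set" where
  "S a = {p. degree p \<le> a}"

definition prodsp :: "complex poly set \<Rightarrow> complex poly set \<Rightarrow> complex poly set" where
  "prodsp V W = pspan {f * g | f g. f \<in> V \<and> g \<in> W}"

definition filling_ratio :: "complex poly set \<Rightarrow> complex poly set \<Rightarrow> real" where
  "filling_ratio V W = real (pdim (prodsp V W)) / real (pdim W)"

text \<open>theta_iter N i = theta^(i+1)(infinity): theta(infinity) = N, theta(x) = N - 1/x.\<close>
fun theta_iter :: "nat \<Rightarrow> nat \<Rightarrow> real" where
  "theta_iter N 0 = real N"
| "theta_iter N (Suc i) = real N - 1 / theta_iter N i"

definition psi :: "nat \<Rightarrow> real" where
  "psi N = (real N + sqrt (real N ^ 2 - 4)) / 2"

text \<open>Membership of a finite (rational) number in Psi_N (infinity = theta^0(infinity) is not finite).\<close>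
definition in_Psi :: "nat \<Rightarrow> real \<Rightarrow> bool" where
  "in_Psi N \<alpha> \<longleftrightarrow> (\<alpha> \<in> \<rat> \<and> 1 < \<alpha> \<and> \<alpha> < psi N) \<or> (\<exists>i. \<alpha> = theta_iter N i)"

inductive poly_fun :: "'v set \<Rightarrow> (('v \<Rightarrow> complex) \<Rightarrow> complex) \<Rightarrow> bool" for X where
  pf_const: "poly_fun X (\<lambda>m. c)"
| pf_var: "x \<in> X \<Longrightarrow> poly_fun X (\<lambda>m. m x)"
| pf_add: "poly_fun X f \<Longrightarrow> poly_fun X g \<Longrightarrow> poly_fun X (\<lambda>m. f m + g m)"
| pf_mult: "poly_fun X f \<Longrightarrow> poly_fun X g \<Longrightarrow> poly_fun X (\<lambda>m. f m * g m)"

definition row_poly :: "(nat \<times> nat \<Rightarrow> complex) \<Rightarrow> nat \<Rightarrow> nat \<Rightarrow> complex poly" where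
  "row_poly m d i = (\<Sum>j\<le>d. monom (m (i, j)) j)"

definition span_rows :: "(nat \<times> nat \<Rightarrow> complex) \<Rightarrow> nat \<Rightarrow> nat \<Rightarrow> complex poly set" where
  "span_rows m N d = pspan (row_poly m d ` {..<N})"

text \<open>A property P holds for a general N-dimensional subspace of S_d:
  there is a nonzero polynomial f in the N(d+1) matrix entries such that every coefficient
  matrix m with f m \<noteq> 0 has rows spanning an N-dimensional V satisfying P.
  (Equivalent to: P holds on a nonempty Zariski-open subset of Gr(N, S_d).)\<close>
definition general_subspace :: "nat \<Rightarrow> nat \<Rightarrow> (complex poly set \<Rightarrow> bool) \<Rightarrow> bool" where
  "general_subspace N d P \<longleftrightarrow>
     (\<exists>f. poly_fun ({..<N} \<times> {..d}) f \<and> (\<exists>m. f m \<noteq> 0) \<and>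
        (\<forall>m. f m \<noteq> 0 \<longrightarrow> pdim (span_rows m N d) = N \<and> P (span_rows m N d)))"

end

theory Submission
  imports Defs
begin

text \<open>The inequality follows from a certificate: scalar \<open>p \<times> q\<close> matrices \<open>B\<^sub>i\<close> with \<open>q a = p b\<close> for
  which \<open>\<Sum>i. f\<^sub>i B\<^sub>i\<close> (\<open>f\<^sub>i\<close> spanning \<open>V\<close>) maps \<open>S\<^bsub>a-1\<^esub>\<^sup>q\<close> injectively to \<open>S\<^bsub>b-1\<^esub>\<^sup>p\<close>; restricting to \<open>W\<^sup>q\<close> gives
  \<open>q dim W \<le> p dim (V W)\<close>. For fixed \<open>B\<close> this is an open condition on \<open>V\<close>, so one pair \<open>(V, B)\<close>
  suffices. Such pairs arise in three ways. If \<open>b \<le> 2 a\<close>, take \<open>V = \<langle>1, u\<^sup>\<rho>, u\<^bsup>b-a\<^esup>\<rangle>\<close> with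
  \<open>\<rho> = a mod (b - a)\<close> and solve a transport problem between monomials. Passing from \<open>V\<close> to
  \<open>\<langle>1\<rangle> \<oplus> u\<^sup>a V\<close> replaces \<open>(N, b/a)\<close> by \<open>(N + 1, b/a + 1)\<close>. Finally, the reflection
  \<open>(a, b) \<mapsto> (N a - b, a)\<close>, under which \<open>\<Psi>\<^sub>N\<close> is stable, lifts certificates back and covers
  \<open>b/a \<ge> N - 1\<close>.\<close>

section \<open>Linear systems with polynomial coefficients\<close>

text \<open>Each added equation costs at most one column of the kernel. The last clause states
  independence of the columns of \<open>K\<close> as injectivity, the form in which it is consumed
  later.\<close>

lemma kernel_basis:
  fixes E :: "'i \<Rightarrow> 'j \<Rightarrow> complex"
  assumes "finite I" "finite J"
  shows "\<exists>n (K :: 'j \<Rightarrow> nat \<Rightarrow> complex). card J \<le> n + card I \<and>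
           (\<forall>i\<in>I. \<forall>t<n. (\<Sum>j\<in>J. E i j * K j t) = 0) \<and>
           (\<forall>v. (\<forall>j\<in>J. (\<Sum>t<n. K j t * v t) = 0) \<longrightarrow> (\<forall>t<n. v t = 0))"
  using assms(1)
proof (induction I)
  case empty
  obtain h where h: "bij_betw h {0..<card J} J"
    using ex_bij_betw_nat_finite[OF assms(2)] by blast
  define K where "K = (\<lambda>j t. if j = h t then 1 else (0::complex))"
  have "v t = 0" if v: "\<forall>j\<in>J. (\<Sum>t<card J. K j t * v t) = 0" and t: "t < card J" for v t
  proof -
    have inj: "h s = h t \<longleftrightarrow> s = t" if "s < card J" for s
      using h t that unfolding bij_betw_def inj_on_def by auto
    have "h t \<in> J" using h t unfolding bij_betw_def by auto
    then have "0 = (\<Sum>s<card J. K (h t) s * v s)" using v by auto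
    also have "\<dots> = (\<Sum>s<card J. if s = t then v s else 0)"
    proof (rule sum.cong[OF refl])
      fix s assume "s \<in> {..<card J}"
      then have "K (h t) s = (if s = t then 1 else 0)"
        using inj[of s] unfolding K_def by fastforce
      then show "K (h t) s * v s = (if s = t then v s else 0)" by simp
    qed
    also have "\<dots> = v t" using t by simp
    finally show ?thesis by simp
  qed
  then show ?case by (intro exI[of _ "card J"] exI[of _ K]) auto
next
  case (insert i I)
  obtain n K where n: "card J \<le> n + card I"
    and K0: "\<And>k t. k \<in> I \<Longrightarrow> t < n \<Longrightarrow> (\<Sum>j\<in>J. E k j * K j t) = 0"
    and Kinj: "\<And>v. (\<forall>j\<in>J. (\<Sum>t<n. K j t * v t) = 0) \<Longrightarrow> (\<forall>t<n. v t = 0)"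
    using insert.IH by blast
  define l where "l t = (\<Sum>j\<in>J. E i j * K j t)" for t
  show ?case
  proof (cases "\<forall>t<n. l t = 0")
    case True
    then show ?thesis
      using n K0 Kinj insert.hyps by (intro exI[of _ n] exI[of _ K]) (auto simp: l_def)
  next
    case False
    then obtain s where s: "s < n" "l s \<noteq> 0" by auto
    then obtain m where m: "n = Suc m" by (cases n) auto
    define g where "g t = (if t < s then t else Suc t)" for t
    have g_inj: "inj_on g {..<m}" by (auto simp: inj_on_def g_def split: if_splits)
    have g_im: "g ` {..<m} = {..<n} - {s}"
    proof
      show "g ` {..<m} \<subseteq> {..<n} - {s}" using s m by (auto simp: g_def)
      show "{..<n} - {s} \<subseteq> g ` {..<m}"
      proof
        fix t assume t: "t \<in> {..<n} - {s}"
        then have "t = g (if t < s then t else t - 1)" "(if t < s then t else t - 1) < m"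
          using s m by (auto simp: g_def)
        then show "t \<in> g ` {..<m}" by blast
      qed
    qed
    define K' where "K' j t = K j (g t) - l (g t) / l s * K j s" for j t
    have gn: "g t < n" if "t < m" for t using that m by (auto simp: g_def)
    have A: "(\<Sum>j\<in>J. E k j * K' j t) = (\<Sum>j\<in>J. E k j * K j (g t)) - l (g t) / l s * (\<Sum>j\<in>J. E k j * K j s)" for k t
      by (simp add: K'_def algebra_simps sum_subtractf sum_distrib_left)
    have B: "(\<Sum>j\<in>J. E k j * K' j t) = 0" if "k \<in> insert i I" "t < m" for k t
    proof (cases "k = i")
      case True
      then show ?thesis unfolding A by (simp add: l_def[symmetric] s)
    next
      case False
      then show ?thesis unfolding A using K0[of k] that gn s by auto
    qed
    have C: "v t = 0" if v: "\<forall>j\<in>J. (\<Sum>t<m. K' j t * v t) = 0" and t: "t < m" for v t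
    proof -
      \<comment> \<open>A relation \<open>v\<close> between the new columns is one between the old
        columns, in which column \<open>s\<close> receives the total of the subtracted
        multiples.\<close>
      define c where "c = - (\<Sum>t<m. l (g t) / l s * v t)"
      define w where "w u = (if u = s then c else v (the_inv_into {..<m} g u))" for u
      have wg: "w (g t) = v t" if "t < m" for t
      proof -
        have "g t \<noteq> s" by (simp add: g_def)
        moreover have "the_inv_into {..<m} g (g t) = t"
          using the_inv_into_f_f[OF g_inj] that by simp
        ultimately show ?thesis by (simp add: w_def)
      qed
      have "(\<Sum>u<n. K j u * w u) = 0" if "j \<in> J" for j
      proof -
        have "(\<Sum>u<n. K j u * w u) = K j s * w s + (\<Sum>u\<in>g ` {..<m}. K j u * w u)"
          unfolding g_im using s by (subst sum.remove[of _ s]) auto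
        also have "(\<Sum>u\<in>g ` {..<m}. K j u * w u) = (\<Sum>t<m. K j (g t) * v t)"
          by (subst sum.reindex[OF g_inj]) (auto simp: wg)
        also have "K j s * w s = - (\<Sum>t<m. l (g t) / l s * K j s * v t)"
          by (simp add: w_def c_def sum_distrib_left algebra_simps)
        also have "\<dots> + (\<Sum>t<m. K j (g t) * v t) = (\<Sum>t<m. K' j t * v t)"
          by (simp add: K'_def algebra_simps sum_subtractf)
        finally show ?thesis using v that by simp
      qed
      then have "w (g t) = 0" using Kinj[of w] gn[OF t] by blast
      then show ?thesis using wg t by simp
    qed
    show ?thesis
      using n m insert.hyps B C by (intro exI[of _ m] exI[of _ K']) auto
  qed
qed

lemma homogeneous_system_nontrivial:
  fixes E :: "'i \<Rightarrow> 'j \<Rightarrow> complex"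
  assumes "finite I" "finite J" "card I < card J"
  obtains v where "\<And>i. i \<in> I \<Longrightarrow> (\<Sum>j\<in>J. E i j * v j) = 0" "\<exists>j\<in>J. v j \<noteq> 0"
proof -
  obtain n K where n: "card J \<le> n + card I"
    and K: "\<forall>i\<in>I. \<forall>t<n. (\<Sum>j\<in>J. E i j * K j t) = 0"
    and inj: "\<forall>v. (\<forall>j\<in>J. (\<Sum>t<n. K j t * v t) = 0) \<longrightarrow> (\<forall>t<n. v t = (0::complex))"
    using kernel_basis[OF assms(1,2), of E] by blast
  have "0 < n" using n assms(3) by linarith
  moreover have "\<exists>j\<in>J. K j 0 \<noteq> 0"
  proof (rule ccontr)
    assume "\<not> ?thesis"
    then have "(\<Sum>t<n. K j t * (if t = 0 then 1 else 0)) = 0" if "j \<in> J" for j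
      using that by (auto intro!: sum.neutral)
    then show False using inj[rule_format, of "\<lambda>t. if t = 0 then 1 else 0" 0] \<open>0 < n\<close> by auto
  qed
  ultimately show thesis using K that[of "\<lambda>j. K j 0"] by blast
qed

section \<open>Polynomial functions and their nonvanishing\<close>

lemma poly_fun_uminus: "poly_fun X f \<Longrightarrow> poly_fun X (\<lambda>m. - f m)"
  using pf_mult[OF pf_const[of X "-1"], of f] by simp

lemma poly_fun_diff: "poly_fun X f \<Longrightarrow> poly_fun X g \<Longrightarrow> poly_fun X (\<lambda>m. f m - g m)"
  using pf_add[OF _ poly_fun_uminus, of X f g] by simp

lemma poly_fun_sum:
  "(\<And>i. i \<in> I \<Longrightarrow> poly_fun X (f i)) \<Longrightarrow> poly_fun X (\<lambda>m. \<Sum>i\<in>I. f i m)"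
  by (induction I rule: infinite_finite_induct) (auto intro: poly_fun.intros)

lemma poly_fun_line:
  assumes "poly_fun X f"
  shows "\<exists>P. \<forall>t. f (\<lambda>x. m x + t * k x) = poly P t"
  using assms
proof induction
  case (pf_const c)
  show ?case by (rule exI[of _ "[:c:]"]) simp
next
  case (pf_var x)
  show ?case by (rule exI[of _ "[:m x, k x:]"]) simp
next
  case (pf_add f g)
  then obtain P Q where "\<forall>t. f (\<lambda>x. m x + t * k x) = poly P t" "\<forall>t. g (\<lambda>x. m x + t * k x) = poly Q t" by blast
  then show ?case by (intro exI[of _ "P + Q"]) simp
next
  case (pf_mult f g)
  then obtain P Q where "\<forall>t. f (\<lambda>x. m x + t * k x) = poly P t" "\<forall>t. g (\<lambda>x. m x + t * k x) = poly Q t" by blast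
  then show ?case by (intro exI[of _ "P * Q"]) simp
qed

text \<open>On the line joining \<open>m\<close> and \<open>k\<close> both factors are nonzero
  univariate polynomials, hence so is their product. Thus two nonempty basic open sets meet.\<close>

lemma poly_fun_mult_nonzero:
  assumes "poly_fun X f" "poly_fun X g" "f m \<noteq> 0" "g k \<noteq> 0"
  shows "\<exists>x. f x * g x \<noteq> 0"
proof -
  obtain P Q where PQ: "\<And>t. f (\<lambda>x. m x + t * (k x - m x)) = poly P t"
    "\<And>t. g (\<lambda>x. m x + t * (k x - m x)) = poly Q t"
    using poly_fun_line[OF assms(1), of m "\<lambda>x. k x - m x"]
      poly_fun_line[OF assms(2), of m "\<lambda>x. k x - m x"] by blast
  have "P \<noteq> 0" using PQ(1)[of 0] assms(3) by auto
  moreover have "Q \<noteq> 0" using PQ(2)[of 1] assms(4) by auto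
  ultimately have "P * Q \<noteq> 0" by simp
  then obtain t where "poly (P * Q) t \<noteq> 0" using poly_all_0_iff_0 by blast
  then show ?thesis using PQ by (metis poly_mult)
qed

lemma poly_fun_common_nonzero:
  assumes "finite I" "\<And>i. i \<in> I \<Longrightarrow> poly_fun X (f i)" "\<And>i. i \<in> I \<Longrightarrow> \<exists>m. f i m \<noteq> 0"
  shows "\<exists>m. \<forall>i\<in>I. f i m \<noteq> 0"
proof -
  have "\<exists>g m. poly_fun X g \<and> g m \<noteq> 0 \<and> (\<forall>m. g m \<noteq> 0 \<longrightarrow> (\<forall>i\<in>I. f i m \<noteq> 0))"
    using assms
  proof induction
    case empty
    show ?case by (intro exI[of _ "\<lambda>_. 1"]) (auto intro: pf_const)
  next
    case (insert i I)
    then obtain g m k where "poly_fun X g" "g m \<noteq> 0" "\<forall>m. g m \<noteq> 0 \<longrightarrow> (\<forall>i\<in>I. f i m \<noteq> 0)"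
      "f i k \<noteq> 0" by (metis insertCI)
    moreover have "poly_fun X (f i)" using insert.prems by auto
    ultimately show ?case
      using poly_fun_mult_nonzero[of X g "f i" m k]
      by (intro exI[of _ "\<lambda>m. g m * f i m"]) (auto intro: pf_mult)
  qed
  then show ?thesis by blast
qed

text \<open>Fraction-free Gaussian elimination: the product of the pivots is the required polynomial.\<close>
lemma injectivity_open:
  fixes A :: "('v \<Rightarrow> complex) \<Rightarrow> 'i \<Rightarrow> 'j \<Rightarrow> complex"
  assumes "finite J" "\<And>i j. i \<in> I \<Longrightarrow> j \<in> J \<Longrightarrow> poly_fun X (\<lambda>m. A m i j)"
    and "\<And>v. \<forall>i\<in>I. (\<Sum>j\<in>J. A m0 i j * v j) = 0 \<Longrightarrow> \<forall>j\<in>J. v j = 0"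
  shows "\<exists>f. poly_fun X f \<and> f m0 \<noteq> 0 \<and>
           (\<forall>m. f m \<noteq> 0 \<longrightarrow> (\<forall>v. (\<forall>i\<in>I. (\<Sum>j\<in>J. A m i j * v j) = 0) \<longrightarrow> (\<forall>j\<in>J. v j = 0)))"
  using assms
proof (induction J arbitrary: A)
  case empty
  show ?case by (intro exI[of _ "\<lambda>_. 1"]) (auto intro: pf_const)
next
  case (insert k J)
  have "\<exists>i\<in>I. A m0 i k \<noteq> 0"
  proof (rule ccontr)
    assume "\<not> ?thesis"
    then have "\<forall>i\<in>I. (\<Sum>j\<in>insert k J. A m0 i j * (if j = k then 1 else 0)) = 0"
      by (auto intro!: sum.neutral)
    from insert.prems(2)[OF this] show False by simp
  qed
  then obtain i0 where i0: "i0 \<in> I" "A m0 i0 k \<noteq> 0" by blast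
  \<comment> \<open>Cross-multiplication with the pivot row \<open>i0\<close> eliminates column
    \<open>k\<close> without division, so the entries stay polynomial.\<close>
  define A' where "A' m i j = A m i0 k * A m i j - A m i k * A m i0 j" for m i j
  have A': "(\<Sum>j\<in>J. A' m i j * v j) =
      A m i0 k * (\<Sum>j\<in>J. A m i j * v j) - A m i k * (\<Sum>j\<in>J. A m i0 j * v j)" for m i v
    by (simp add: A'_def algebra_simps sum_subtractf sum_distrib_left)
  have "poly_fun X (\<lambda>m. A' m i j)" if "i \<in> I" "j \<in> J" for i j
    unfolding A'_def using that i0 insert.prems(1) by (intro poly_fun_diff pf_mult) auto
  moreover have "\<forall>j\<in>J. v j = 0" if v: "\<forall>i\<in>I. (\<Sum>j\<in>J. A' m0 i j * v j) = 0" for v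
  proof -
    define w where "w = v(k := - (\<Sum>j\<in>J. A m0 i0 j * v j) / A m0 i0 k)"
    have "(\<Sum>j\<in>insert k J. A m0 i j * w j) = 0" if "i \<in> I" for i
    proof -
      have "(\<Sum>j\<in>insert k J. A m0 i j * w j) = A m0 i k * w k + (\<Sum>j\<in>J. A m0 i j * w j)"
        using insert.hyps by simp
      also have "(\<Sum>j\<in>J. A m0 i j * w j) = (\<Sum>j\<in>J. A m0 i j * v j)"
        by (rule sum.cong) (use insert.hyps in \<open>auto simp: w_def\<close>)
      also have "A m0 i k * w k + \<dots> = (\<Sum>j\<in>J. A' m0 i j * v j) / A m0 i0 k"
        unfolding A' w_def using i0 by (simp add: field_simps)
      finally show ?thesis using v that by simp
    qed
    then have "\<forall>j\<in>insert k J. w j = 0" by (intro insert.prems(2)) blast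
    then show ?thesis using insert.hyps by (auto simp: w_def split: if_splits)
  qed
  ultimately obtain f where f: "poly_fun X f" "f m0 \<noteq> 0"
    "\<And>m v. f m \<noteq> 0 \<Longrightarrow> \<forall>i\<in>I. (\<Sum>j\<in>J. A' m i j * v j) = 0 \<Longrightarrow> \<forall>j\<in>J. v j = 0"
    using insert.IH[of A'] by blast
  have "\<forall>j\<in>insert k J. v j = 0"
    if m: "f m * A m i0 k \<noteq> 0" and v: "\<forall>i\<in>I. (\<Sum>j\<in>insert k J. A m i j * v j) = 0" for m v
  proof -
    have e: "(\<Sum>j\<in>J. A m i j * v j) = - A m i k * v k" if "i \<in> I" for i
      using v that insert.hyps by (simp add: eq_neg_iff_add_eq_0 add.commute)
    have "\<forall>i\<in>I. (\<Sum>j\<in>J. A' m i j * v j) = 0" unfolding A' using e i0 by simp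
    then have *: "\<forall>j\<in>J. v j = 0" using f(3) m by auto
    have "A m i0 k * v k = 0" using e[OF i0(1)] * by simp
    then show ?thesis using * m by auto
  qed
  moreover have "poly_fun X (\<lambda>m. f m * A m i0 k)"
    by (rule pf_mult[OF f(1)]) (use i0 insert.prems(1) in simp)
  moreover have "f m0 * A m0 i0 k \<noteq> 0" using f(2) i0(2) by simp
  ultimately show ?case by (intro exI[of _ "\<lambda>m. f m * A m i0 k"] conjI allI impI)
qed

section \<open>Certificates for the filling ratio\<close>

text \<open>This is \<open>S (a - 1)\<close> for \<open>a > 0\<close> and the zero space for
  \<open>a = 0\<close>, in line with \<open>S_{-1} = 0\<close>; truncated subtraction would instead
  leave the constants.\<close>

definition low_deg :: "nat \<Rightarrow> complex poly \<Rightarrow> bool" where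
  "low_deg a p \<longleftrightarrow> (\<forall>n\<ge>a. coeff p n = 0)"

lemma low_deg_0 [simp]: "low_deg a 0"
  by (simp add: low_deg_def)

lemma low_deg_add: "low_deg a p \<Longrightarrow> low_deg a q \<Longrightarrow> low_deg a (p + q)"
  by (simp add: low_deg_def)

lemma low_deg_uminus: "low_deg a p \<Longrightarrow> low_deg a (- p)"
  by (simp add: low_deg_def)

lemma low_deg_smult: "low_deg a p \<Longrightarrow> low_deg a (smult c p)"
  by (simp add: low_deg_def)

lemma low_deg_sum: "(\<And>x. x \<in> A \<Longrightarrow> low_deg a (p x)) \<Longrightarrow> low_deg a (\<Sum>x\<in>A. p x)"
  by (simp add: low_deg_def coeff_sum)

lemma low_degI_degree: "degree p < a \<Longrightarrow> low_deg a p"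
  by (simp add: low_deg_def coeff_eq_0)

lemma low_deg_0_iff: "low_deg 0 p \<longleftrightarrow> p = 0"
  by (auto simp: low_deg_def poly_eq_iff)

lemma low_deg_degree: "low_deg a p \<Longrightarrow> p \<noteq> 0 \<Longrightarrow> degree p < a"
  by (meson leading_coeff_0_iff low_deg_def not_le)

lemma low_deg_mult:
  assumes "degree p \<le> d" "low_deg a q"
  shows "low_deg (a + d) (p * q)"
proof (cases "q = 0")
  case False
  then have "degree (p * q) < a + d"
    using low_deg_degree[OF assms(2)] degree_mult_le[of p q] assms(1) by linarith
  then show ?thesis by (rule low_degI_degree)
qed simp

lemma low_deg_expand:
  assumes "low_deg a p" shows "p = (\<Sum>x<a. monom (coeff p x) x)"
  using assms by (auto simp: poly_eq_iff coeff_sum low_deg_def sum.delta' if_distrib not_less cong: if_cong)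

lemma coeff_mult_low_deg:
  assumes "low_deg a q"
  shows "coeff (p * q) y = (\<Sum>x<a. (if x \<le> y then coeff p (y - x) else 0) * coeff q x)"
proof -
  have "coeff (p * q) y = (\<Sum>x\<le>y. coeff p (y - x) * coeff q x)"
    unfolding mult.commute[of p q] coeff_mult by (simp add: mult.commute)
  also have "\<dots> = (\<Sum>x\<in>{..y} \<inter> {..<a}. coeff p (y - x) * coeff q x)"
    using assms by (intro sum.mono_neutral_right) (auto simp: low_deg_def linorder_not_less[symmetric])
  also have "\<dots> = (\<Sum>x<a. (if x \<le> y then coeff p (y - x) else 0) * coeff q x)"
    by (rule sum.mono_neutral_cong_left) auto
  finally show ?thesis .
qed

text \<open>Injectivity of the pencil formed from the \<open>f i\<close> and the scalar matrices
  \<open>B i\<close>, acting on \<open>Q\<close>-tuples of polynomials of degree below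
  \<open>a\<close>. Arbitrary index types allow pairs and disjoint sums as labels.\<close>

definition mult_inj ::
  "nat \<Rightarrow> nat \<Rightarrow> (nat \<Rightarrow> complex poly) \<Rightarrow> 'r set \<Rightarrow> 'c set \<Rightarrow> (nat \<Rightarrow> 'r \<Rightarrow> 'c \<Rightarrow> complex) \<Rightarrow> bool"
  where "mult_inj N a f P Q B \<longleftrightarrow>
    (\<forall>\<phi>. (\<forall>c\<in>Q. low_deg a (\<phi> c)) \<longrightarrow>
         (\<forall>r\<in>P. (\<Sum>c\<in>Q. (\<Sum>i<N. smult (B i r c) (f i)) * \<phi> c) = 0) \<longrightarrow> (\<forall>c\<in>Q. \<phi> c = 0))"

interpretation pvs: vector_space "smult :: complex \<Rightarrow> complex poly \<Rightarrow> complex poly"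
  by (rule vector_space_smult_poly)

lemma low_deg_in_span_monoms:
  assumes "low_deg a p" shows "p \<in> pspan (monom 1 ` {..<a})"
proof -
  have "(\<Sum>x<a. smult (coeff p x) (monom 1 x)) \<in> pspan (monom 1 ` {..<a})"
    by (intro pvs.span_sum pvs.span_scale pvs.span_base) auto
  then show ?thesis using low_deg_expand[OF assms] by (simp add: smult_monom)
qed

lemma low_deg_basis:
  assumes "\<And>w. w \<in> W \<Longrightarrow> low_deg a w"
  obtains C where "C \<subseteq> W" "finite C" "pvs.independent C" "W \<subseteq> pspan C" "card C = pdim W"
proof -
  obtain C where C: "C \<subseteq> W" "pvs.independent C" "W \<subseteq> pspan C" "card C = pdim W"
    using pvs.basis_exists by blast
  have "C \<subseteq> pspan (monom 1 ` {..<a})" using C(1) assms low_deg_in_span_monoms by blast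
  then have "finite C" using pvs.independent_span_bound C(2) by blast
  then show thesis using C that by blast
qed

lemma low_deg_prodsp:
  assumes "V \<subseteq> S d" "\<And>w. w \<in> W \<Longrightarrow> low_deg a w" "z \<in> prodsp V W"
  shows "low_deg (a + d) z"
  using assms(3) unfolding prodsp_def
proof (induction rule: pvs.span_induct_alt)
  case (step c x y)
  then obtain f g where "x = f * g" "f \<in> V" "g \<in> W" by blast
  then have "low_deg (a + d) x" using assms(1,2) low_deg_mult[of f d a g] by (auto simp: S_def)
  then show ?case using step by (intro low_deg_add low_deg_smult)
qed simp

text \<open>Since the \<open>B i\<close> are scalar, the pencil maps \<open>Q\<close>-tuples from
  \<open>W\<close> to \<open>P\<close>-tuples from \<open>prodsp V W\<close>, and injectivity
  compares dimensions.\<close>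

lemma mult_inj_dim_bound:
  assumes inj: "mult_inj N a f P Q B" and fin: "finite P" "finite Q"
    and f: "\<And>i. i < N \<Longrightarrow> f i \<in> V" and V: "V \<subseteq> S d"
    and W: "\<And>w. w \<in> W \<Longrightarrow> low_deg a w"
  shows "card Q * pdim W \<le> card P * pdim (prodsp V W)"
proof (rule ccontr)
  assume less: "\<not> ?thesis"
  obtain C where C: "C \<subseteq> W" "finite C" "pvs.independent C" "W \<subseteq> pspan C" "card C = pdim W"
    using low_deg_basis[of W a] W by blast
  obtain D where D: "D \<subseteq> prodsp V W" "finite D" "pvs.independent D" "prodsp V W \<subseteq> pspan D"
    "card D = pdim (prodsp V W)"
    using low_deg_basis[of "prodsp V W" "a + d"] low_deg_prodsp[of V d W a] V W by blast
  have "\<forall>i w. \<exists>u. i < N \<and> w \<in> C \<longrightarrow> f i * w = (\<Sum>z\<in>D. smult (u z) z)"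
  proof (intro allI)
    fix i w
    have "f i * w \<in> range (\<lambda>u. \<Sum>z\<in>D. smult (u z) z)" if "i < N" "w \<in> C"
    proof -
      have "f i * w \<in> prodsp V W"
        unfolding prodsp_def by (rule pvs.span_base) (use f that C(1) in blast)
      then show ?thesis using D(4) pvs.span_finite[OF D(2)] by blast
    qed
    then show "\<exists>u. i < N \<and> w \<in> C \<longrightarrow> f i * w = (\<Sum>z\<in>D. smult (u z) z)" by blast
  qed
  then obtain R where R: "\<And>i w. i < N \<Longrightarrow> w \<in> C \<Longrightarrow> f i * w = (\<Sum>z\<in>D. smult (R i w z) z)"
    by metis
  \<comment> \<open>The matrix of the restricted pencil in the bases \<open>C\<close> and
    \<open>D\<close>; if the bound fails, it has more columns than rows.\<close>
  define E where "E = (\<lambda>(r, z) (c, w). \<Sum>i<N. B i r c * R i w z)"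
  have "card (P \<times> D) < card (Q \<times> C)"
    using less C(5) D(5) by (simp add: card_cartesian_product)
  then obtain v where v: "\<And>k. k \<in> P \<times> D \<Longrightarrow> (\<Sum>j\<in>Q \<times> C. E k j * v j) = 0" "\<exists>j\<in>Q \<times> C. v j \<noteq> 0"
    using homogeneous_system_nontrivial[of "P \<times> D" "Q \<times> C" E] fin C(2) D(2) by auto
  define \<phi> where "\<phi> c = (\<Sum>w\<in>C. smult (v (c, w)) w)" for c
  have "low_deg a (\<phi> c)" for c
    unfolding \<phi>_def using W C(1) by (intro low_deg_sum low_deg_smult) auto
  moreover have "(\<Sum>c\<in>Q. (\<Sum>i<N. smult (B i r c) (f i)) * \<phi> c) = 0" if r: "r \<in> P" for r
  proof -
    have "(\<Sum>i<N. smult (B i r c) (f i)) * \<phi> c = (\<Sum>w\<in>C. \<Sum>z\<in>D. smult (E (r, z) (c, w) * v (c, w)) z)" for c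
    proof -
      have "(\<Sum>i<N. smult (B i r c) (f i)) * \<phi> c =
          (\<Sum>w\<in>C. \<Sum>i<N. smult (B i r c * v (c, w)) (f i * w))"
        unfolding \<phi>_def sum_product by (subst sum.swap) (simp add: mult.commute)
      also have "\<dots> = (\<Sum>w\<in>C. \<Sum>i<N. smult (B i r c * v (c, w)) (\<Sum>z\<in>D. smult (R i w z) z))"
        using R by simp
      also have "\<dots> = (\<Sum>w\<in>C. \<Sum>i<N. \<Sum>z\<in>D. smult (B i r c * R i w z * v (c, w)) z)"
        by (simp add: pvs.scale_sum_right mult_ac)
      also have "\<dots> = (\<Sum>w\<in>C. \<Sum>z\<in>D. \<Sum>i<N. smult (B i r c * R i w z * v (c, w)) z)"
        by (intro sum.cong[OF refl] sum.swap)
      also have "\<dots> = (\<Sum>w\<in>C. \<Sum>z\<in>D. smult (E (r, z) (c, w) * v (c, w)) z)"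
        by (simp add: E_def sum_distrib_right pvs.scale_sum_left)
      finally show ?thesis .
    qed
    then have "(\<Sum>c\<in>Q. (\<Sum>i<N. smult (B i r c) (f i)) * \<phi> c) =
        (\<Sum>j\<in>Q \<times> C. \<Sum>z\<in>D. smult (E (r, z) j * v j) z)"
      using sum.cartesian_product[of "\<lambda>c w. \<Sum>z\<in>D. smult (E (r, z) (c, w) * v (c, w)) z" C Q]
      by (simp add: case_prod_unfold)
    also have "\<dots> = (\<Sum>z\<in>D. \<Sum>j\<in>Q \<times> C. smult (E (r, z) j * v j) z)"
      by (rule sum.swap)
    also have "\<dots> = (\<Sum>z\<in>D. smult (\<Sum>j\<in>Q \<times> C. E (r, z) j * v j) z)"
      by (simp add: pvs.scale_sum_left)
    also have "\<dots> = 0" using v(1) r by simp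
    finally show ?thesis .
  qed
  ultimately have \<phi>0: "\<forall>c\<in>Q. \<phi> c = 0"
    using inj unfolding mult_inj_def by blast
  have "v (c, w) = 0" if "c \<in> Q" "w \<in> C" for c w
    using pvs.independentD[OF C(3,2) subset_refl, of "\<lambda>w. v (c, w)" w] \<phi>0 that by (simp add: \<phi>_def)
  then show False using v(2) by auto
qed

section \<open>Openness in the coefficients of V\<close>

text \<open>Comparing coefficients of \<open>u^y\<close> in row \<open>r\<close> turns the condition
  into a linear system for the coefficients of the \<open>\<phi> c\<close>. Its entries are linear
  in the coefficients of the \<open>f i\<close>, so \<open>injectivity_open\<close> becomes
  applicable.\<close>

lemma mult_inj_iff_coeffs:
  assumes fin: "finite Q"
  shows "mult_inj N a f P Q B \<longleftrightarrow>
    (\<forall>v. (\<forall>k\<in>P \<times> UNIV. (\<Sum>j\<in>Q \<times> {..<a}.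
        (\<Sum>i<N. B i (fst k) (fst j) * (if snd j \<le> snd k then coeff (f i) (snd k - snd j) else 0)) * v j) = 0) \<longrightarrow>
        (\<forall>j\<in>Q \<times> {..<a}. v j = 0))"
    (is "_ \<longleftrightarrow> (\<forall>v. (\<forall>k\<in>_. (\<Sum>j\<in>_. ?A k j * v j) = 0) \<longrightarrow> _)")
proof -
  have key: "coeff (\<Sum>c\<in>Q. (\<Sum>i<N. smult (B i r c) (f i)) * \<phi> c) y =
      (\<Sum>j\<in>Q \<times> {..<a}. ?A (r, y) j * coeff (\<phi> (fst j)) (snd j))"
    if "\<forall>c\<in>Q. low_deg a (\<phi> c)" for \<phi> r y
  proof -
    have "coeff ((\<Sum>i<N. smult (B i r c) (f i)) * \<phi> c) y = (\<Sum>x<a. ?A (r, y) (c, x) * coeff (\<phi> c) x)"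
      if "c \<in> Q" for c
    proof -
      have "(if x \<le> y then coeff (\<Sum>i<N. smult (B i r c) (f i)) (y - x) else 0) = ?A (r, y) (c, x)" for x
        by (simp add: coeff_sum)
      then show ?thesis
        by (subst coeff_mult_low_deg[of a]) (use that \<open>\<forall>c\<in>Q. low_deg a (\<phi> c)\<close> in auto)
    qed
    then have "coeff (\<Sum>c\<in>Q. (\<Sum>i<N. smult (B i r c) (f i)) * \<phi> c) y =
        (\<Sum>c\<in>Q. \<Sum>x<a. ?A (r, y) (c, x) * coeff (\<phi> c) x)"
      unfolding coeff_sum by (rule sum.cong[OF refl])
    then show ?thesis by (simp add: sum.cartesian_product case_prod_unfold cong: if_cong)
  qed
  show ?thesis
  proof
    assume inj: "mult_inj N a f P Q B"
    show "\<forall>v. (\<forall>k\<in>P \<times> UNIV. (\<Sum>j\<in>Q \<times> {..<a}. ?A k j * v j) = 0) \<longrightarrow> (\<forall>j\<in>Q \<times> {..<a}. v j = 0)"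
    proof (intro allI impI)
      fix v :: "_ \<Rightarrow> complex" assume v: "\<forall>k\<in>P \<times> UNIV. (\<Sum>j\<in>Q \<times> {..<a}. ?A k j * v j) = 0"
      define \<phi> where "\<phi> c = (\<Sum>x<a. monom (v (c, x)) x)" for c
      have co: "coeff (\<phi> c) x = (if x < a then v (c, x) else 0)" for c x
        by (simp add: \<phi>_def coeff_sum sum.delta' if_distrib cong: if_cong)
      then have low: "\<forall>c\<in>Q. low_deg a (\<phi> c)" by (simp add: low_deg_def)
      have "(\<Sum>j\<in>Q \<times> {..<a}. ?A (r, y) j * coeff (\<phi> (fst j)) (snd j)) =
          (\<Sum>j\<in>Q \<times> {..<a}. ?A (r, y) j * v j)" for r y
        by (rule sum.cong) (auto simp: co)
      then have "(\<Sum>c\<in>Q. (\<Sum>i<N. smult (B i r c) (f i)) * \<phi> c) = 0" if "r \<in> P" for r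
        using key[OF low, of r] v that unfolding poly_eq_iff by auto
      then have \<phi>0: "\<forall>c\<in>Q. \<phi> c = 0" using inj low unfolding mult_inj_def by blast
      show "\<forall>j\<in>Q \<times> {..<a}. v j = 0"
      proof
        fix j assume "j \<in> Q \<times> {..<a}"
        then show "v j = 0" using co[of "fst j" "snd j"] \<phi>0 by auto
      qed
    qed
  next
    assume inj: "\<forall>v. (\<forall>k\<in>P \<times> UNIV. (\<Sum>j\<in>Q \<times> {..<a}. ?A k j * v j) = 0) \<longrightarrow> (\<forall>j\<in>Q \<times> {..<a}. v j = 0)"
    show "mult_inj N a f P Q B"
      unfolding mult_inj_def
    proof (intro allI impI)
      fix \<phi> assume low: "\<forall>c\<in>Q. low_deg a (\<phi> c)"
        and eq: "\<forall>r\<in>P. (\<Sum>c\<in>Q. (\<Sum>i<N. smult (B i r c) (f i)) * \<phi> c) = 0"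
      have "\<forall>k\<in>P \<times> UNIV. (\<Sum>j\<in>Q \<times> {..<a}. ?A k j * coeff (\<phi> (fst j)) (snd j)) = 0"
      proof
        fix k assume "k \<in> P \<times> (UNIV :: nat set)"
        then obtain r y where k: "k = (r, y)" "r \<in> P" by auto
        show "(\<Sum>j\<in>Q \<times> {..<a}. ?A k j * coeff (\<phi> (fst j)) (snd j)) = 0"
          unfolding k(1) key[OF low, symmetric] using eq k(2) by simp
      qed
      then have "\<forall>j\<in>Q \<times> {..<a}. coeff (\<phi> (fst j)) (snd j) = 0"
        using inj[rule_format, of "\<lambda>j. coeff (\<phi> (fst j)) (snd j)"] by blast
      then have co: "coeff (\<phi> c) x = 0" if "c \<in> Q" "x < a" for c x
        using that by (auto dest!: bspec[of _ _ "(c, x)"])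
      show "\<forall>c\<in>Q. \<phi> c = 0"
      proof
        fix c assume c: "c \<in> Q"
        show "\<phi> c = 0"
          using low c co[OF c] unfolding poly_eq_iff low_deg_def by (metis coeff_0 not_le)
      qed
    qed
  qed
qed

lemma coeff_row_poly: "coeff (row_poly m d i) j = (if j \<le> d then m (i, j) else 0)"
  by (simp add: row_poly_def coeff_sum sum.delta' if_distrib cong: if_cong)

lemma degree_row_poly: "degree (row_poly m d i) \<le> d"
  by (rule degree_le) (simp add: coeff_row_poly)

lemma span_rows_subset_S: "span_rows m N d \<subseteq> S d"
proof
  fix p assume "p \<in> span_rows m N d"
  then have "low_deg (Suc d) p"
    unfolding span_rows_def
  proof (induction rule: pvs.span_induct_alt)
    case (step c x y)
    have "low_deg (Suc d) (row_poly m d i)" for i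
      by (rule low_degI_degree) (simp add: degree_row_poly le_imp_less_Suc)
    then show ?case using step by (auto intro!: low_deg_add low_deg_smult)
  qed simp
  then show "p \<in> S d" by (auto simp: S_def low_deg_def intro!: degree_le)
qed

lemma mult_inj_open:
  fixes P :: "'r set" and Q :: "'c set"
  assumes "finite Q" "mult_inj N a (row_poly m0 d) P Q B"
  shows "\<exists>f. poly_fun ({..<N} \<times> {..d}) f \<and> f m0 \<noteq> 0 \<and>
           (\<forall>m. f m \<noteq> 0 \<longrightarrow> mult_inj N a (row_poly m d) P Q B)"
proof -
  define A where "A m k j = (\<Sum>i<N. B i (fst k) (fst j) *
      (if snd j \<le> snd k then coeff (row_poly m d i) (snd k - snd j) else 0))" for m and k :: "'r \<times> nat" and j :: "'c \<times> nat"
  have *: "mult_inj N a (row_poly m d) P Q B \<longleftrightarrow>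
      (\<forall>v. (\<forall>k\<in>P \<times> UNIV. (\<Sum>j\<in>Q \<times> {..<a}. A m k j * v j) = 0) \<longrightarrow> (\<forall>j\<in>Q \<times> {..<a}. v j = 0))" for m
    unfolding A_def by (rule mult_inj_iff_coeffs[OF assms(1)])
  have "poly_fun ({..<N} \<times> {..d}) (\<lambda>m. A m k j)" for k j
    unfolding A_def coeff_row_poly
    by (intro poly_fun_sum pf_mult pf_const, cases "snd j \<le> snd k"; cases "snd k - snd j \<le> d")
      (simp_all add: pf_var pf_const)
  then show ?thesis
    unfolding * using assms injectivity_open[of "Q \<times> {..<a}" "P \<times> UNIV" "{..<N} \<times> {..d}" A m0]
    unfolding * by auto
qed

lemma pdim_span_rows_open:
  assumes "N \<le> d + 1"
  shows "\<exists>f m. poly_fun ({..<N} \<times> {..d}) f \<and> f m \<noteq> 0 \<and> (\<forall>m. f m \<noteq> 0 \<longrightarrow> pdim (span_rows m N d) = N)"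
proof -
  \<comment> \<open>The rows \<open>1, u, ..., u^(N-1)\<close>, which fit into degree
    \<open>d\<close> since \<open>N \<le> d + 1\<close>.\<close>
  define m1 :: "nat \<times> nat \<Rightarrow> complex" where "m1 = (\<lambda>(i, j). if i = j then 1 else 0)"
  have "\<forall>i\<in>{..<N}. v i = 0" if v: "\<forall>j\<in>{..d}. (\<Sum>i\<in>{..<N}. m1 (i, j) * v i) = 0" for v
  proof
    fix i assume "i \<in> {..<N}"
    then show "v i = 0"
      using v[rule_format, of i] assms by (simp add: m1_def if_distrib[of "\<lambda>x. x * _"] cong: if_cong)
  qed
  moreover have "poly_fun ({..<N} \<times> {..d}) (\<lambda>m. m (i, j))" if "j \<in> {..d}" "i \<in> {..<N}" for i j
    using that by (auto intro: pf_var)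
  ultimately obtain f where f: "poly_fun ({..<N} \<times> {..d}) f" "f m1 \<noteq> 0"
    "\<And>m v. f m \<noteq> 0 \<Longrightarrow> \<forall>j\<in>{..d}. (\<Sum>i\<in>{..<N}. m (i, j) * v i) = 0 \<Longrightarrow> \<forall>i\<in>{..<N}. v i = 0"
    using injectivity_open[of "{..<N}" "{..d}" "{..<N} \<times> {..d}" "\<lambda>m j i. m (i, j)" m1] by auto
  have "pdim (span_rows m N d) = N" if m: "f m \<noteq> 0" for m
  proof -
    have indep: "\<forall>i<N. v i = 0" if "(\<Sum>i<N. smult (v i) (row_poly m d i)) = 0" for v
    proof -
      have "(\<Sum>i<N. m (i, j) * v i) = coeff (\<Sum>i<N. smult (v i) (row_poly m d i)) j" if "j \<le> d" for j
        using that by (simp add: coeff_sum coeff_row_poly mult.commute)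
      then show ?thesis using f(3)[OF m, of v] that by auto
    qed
    have inj: "inj_on (row_poly m d) {..<N}"
    proof (rule inj_onI, rule ccontr)
      fix i j assume ij: "i \<in> {..<N}" "j \<in> {..<N}" "row_poly m d i = row_poly m d j" "i \<noteq> j"
      have "(\<Sum>k<N. smult ((if k = i then 1 else 0) - (if k = j then 1 else 0)) (row_poly m d k)) = 0"
        using ij by (simp add: smult_diff_left sum_subtractf if_distrib[of "\<lambda>x. smult x _"] cong: if_cong)
      from indep[OF this] show False using ij by (auto dest!: spec[of _ i])
    qed
    have "pvs.independent (row_poly m d ` {..<N})"
    proof (subst pvs.dependent_finite, simp, rule notI, elim exE conjE)
      fix u assume u: "\<exists>v\<in>row_poly m d ` {..<N}. u v \<noteq> 0" "(\<Sum>v\<in>row_poly m d ` {..<N}. smult (u v) v) = 0"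
      have "(\<Sum>i<N. smult (u (row_poly m d i)) (row_poly m d i)) = 0"
        using u(2) by (simp add: sum.reindex[OF inj])
      from indep[OF this] show False using u(1) by auto
    qed
    then show ?thesis
      unfolding span_rows_def using pvs.dim_span_eq_card_independent card_image[OF inj] by simp
  qed
  then show ?thesis using f(1,2) by blast
qed

text \<open>Injectivity of the pencil for this fixed \<open>B\<close> and independence of the rows
  are both nonempty open conditions; the product of their polynomials cuts out the required open
  set.\<close>

lemma general_subspace_filling_ratio:
  assumes a: "a > 0" and N: "N \<le> d + 1" and inj: "mult_inj N a f P Q B"
    and fin: "finite P" "finite Q" and Q: "card Q > 0" and PQ: "card P * (a + d) \<le> card Q * a"
    and deg: "\<And>i. i < N \<Longrightarrow> degree (f i) \<le> d"
  shows "general_subspace N d (\<lambda>V. \<forall>W. psubspace W \<and> W \<subseteq> S (a - 1) \<and> W \<noteq> {0} \<longrightarrow>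
           real (a + d) / real a \<le> filling_ratio V W)"
proof -
  define m0 where "m0 = (\<lambda>(i, j). coeff (f i) j)"
  have "row_poly m0 d i = f i" if "i < N" for i
    using deg[OF that] by (auto simp: poly_eq_iff coeff_row_poly m0_def coeff_eq_0)
  then have "mult_inj N a (row_poly m0 d) P Q B"
    using inj unfolding mult_inj_def by simp
  then obtain g where g: "poly_fun ({..<N} \<times> {..d}) g" "g m0 \<noteq> 0"
    "\<And>m. g m \<noteq> 0 \<Longrightarrow> mult_inj N a (row_poly m d) P Q B"
    using mult_inj_open[OF fin(2)] by blast
  obtain h m1 where h: "poly_fun ({..<N} \<times> {..d}) h" "h m1 \<noteq> 0"
    "\<And>m. h m \<noteq> 0 \<Longrightarrow> pdim (span_rows m N d) = N"
    using pdim_span_rows_open[OF N] by blast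
  \<comment> \<open>Allows \<open>card P\<close> to be cancelled below. Without rows the pencil
    would kill the constant tuple \<open>1\<close>, which has low degree as
    \<open>a > 0\<close>.\<close>
  have "card P > 0"
  proof (rule ccontr)
    assume "\<not> ?thesis"
    then have "P = {}" using fin by simp
    then have "\<forall>c\<in>Q. (1::complex poly) = 0"
      using inj[unfolded mult_inj_def, rule_format, of "\<lambda>_. 1"] low_degI_degree[of 1 a] a \<open>P = {}\<close> by auto
    then show False using Q by auto
  qed
  have "real (a + d) / real a \<le> filling_ratio (span_rows m N d) W"
    if m: "g m \<noteq> 0" and W: "psubspace W" "W \<subseteq> S (a - 1)" "W \<noteq> {0}" for m W
  proof -
    let ?V = "span_rows m N d"
    have low: "low_deg a w" if "w \<in> W" for w
      using W(2) that a by (auto simp: S_def intro!: low_degI_degree)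
    have "row_poly m d i \<in> ?V" if "i < N" for i
      unfolding span_rows_def using that by (intro pvs.span_base) auto
    then have le: "card Q * pdim W \<le> card P * pdim (prodsp ?V W)"
      using mult_inj_dim_bound[OF g(3)[OF m] fin _ span_rows_subset_S] low by blast
    obtain C where C: "C \<subseteq> W" "finite C" "pvs.independent C" "W \<subseteq> pspan C" "card C = pdim W"
      using low by (rule low_deg_basis)
    have "pdim W > 0"
    proof (rule ccontr)
      assume "\<not> ?thesis"
      then have "W \<subseteq> {0}" using C by auto
      then show False using W(3) pvs.subspace_0[OF W(1)] by blast
    qed
    have "card P * ((a + d) * pdim W) \<le> card P * (a * pdim (prodsp ?V W))"
    proof -
      have "card P * ((a + d) * pdim W) \<le> card Q * a * pdim W"
        using mult_le_mono1[OF PQ, of "pdim W"] by (simp add: mult_ac)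
      also have "\<dots> \<le> card P * (a * pdim (prodsp ?V W))"
        using mult_le_mono1[OF le, of a] by (simp add: mult_ac)
      finally show ?thesis .
    qed
    then have "(a + d) * pdim W \<le> a * pdim (prodsp ?V W)"
      using \<open>card P > 0\<close> by simp
    then have "real (a + d) * real (pdim W) \<le> real a * real (pdim (prodsp ?V W))"
      by (metis of_nat_le_iff of_nat_mult)
    then show ?thesis
      unfolding filling_ratio_def using a \<open>pdim W > 0\<close> by (simp add: field_simps)
  qed
  moreover have "\<exists>m. g m * h m \<noteq> 0" using poly_fun_mult_nonzero g h by blast
  ultimately show ?thesis
    unfolding general_subspace_def using g h
    by (intro exI[of _ "\<lambda>m. g m * h m"]) (auto intro: pf_mult)
qed

section \<open>Existence of certificates\<close>

text \<open>Here \<open>d\<close> is \<open>b - a\<close>. The normalisations serve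
  \<open>cert_reflection\<close>: \<open>f 0 = 1\<close> matches the component
  \<open>z M = y\<close> of a relation, and the top coefficient of \<open>f (N - 1)\<close> fixes
  the degree of \<open>G\<close>. Independence of the rows is dealt with by
  \<open>pdim_span_rows_open\<close>.\<close>

definition filling_cert :: "nat \<Rightarrow> nat \<Rightarrow> nat \<Rightarrow> bool" where
  "filling_cert N a d \<longleftrightarrow> (\<exists>f p q (B :: nat \<Rightarrow> nat \<Rightarrow> nat \<Rightarrow> complex).
     f 0 = 1 \<and> coeff (f (N - 1)) d \<noteq> 0 \<and> (\<forall>i<N. degree (f i) \<le> d) \<and>
     0 < q \<and> p * (a + d) \<le> q * a \<and> mult_inj N a f {..<p} {..<q} B)"

lemma mult_inj_reindex:
  assumes inj: "mult_inj N a f P Q B" and g: "bij_betw g P' P" and h: "bij_betw h Q' Q"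
  shows "mult_inj N a f P' Q' (\<lambda>i r c. B i (g r) (h c))"
  unfolding mult_inj_def
proof (intro allI impI)
  fix \<phi> assume low: "\<forall>c\<in>Q'. low_deg a (\<phi> c)"
    and eq: "\<forall>r\<in>P'. (\<Sum>c\<in>Q'. (\<Sum>i<N. smult (B i (g r) (h c)) (f i)) * \<phi> c) = 0"
  define \<psi> where "\<psi> = \<phi> \<circ> the_inv_into Q' h"
  have \<psi>h: "\<psi> (h c) = \<phi> c" if "c \<in> Q'" for c
    using that h by (simp add: \<psi>_def bij_betw_def the_inv_into_f_f)
  have surj: "h ` Q' = Q" "g ` P' = P" using h g by (auto simp: bij_betw_def)
  have "\<forall>c\<in>Q. low_deg a (\<psi> c)" using low \<psi>h unfolding surj(1)[symmetric] by simp
  moreover have "(\<Sum>c\<in>Q. (\<Sum>i<N. smult (B i r c) (f i)) * \<psi> c) = 0" if "r \<in> P" for r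
  proof -
    obtain r' where r': "r' \<in> P'" "r = g r'" using \<open>r \<in> P\<close> unfolding surj(2)[symmetric] by blast
    have "(\<Sum>c\<in>Q. (\<Sum>i<N. smult (B i r c) (f i)) * \<psi> c) =
        (\<Sum>c\<in>Q'. (\<Sum>i<N. smult (B i r (h c)) (f i)) * \<psi> (h c))"
      by (rule sum.reindex_bij_betw[OF h, symmetric])
    also have "\<dots> = 0" using eq r' \<psi>h by simp
    finally show ?thesis .
  qed
  ultimately have "\<forall>c\<in>Q. \<psi> c = 0" using inj unfolding mult_inj_def by blast
  then show "\<forall>c\<in>Q'. \<phi> c = 0" using \<psi>h surj(1) by force
qed

lemma certI:
  fixes P :: "'r set" and Q :: "'c set"
  assumes "f 0 = 1" "coeff (f (N - 1)) d \<noteq> 0" "\<And>i. i < N \<Longrightarrow> degree (f i) \<le> d"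
    and fin: "finite P" "finite Q" and card: "0 < card Q" "card P * (a + d) \<le> card Q * a"
    and inj: "mult_inj N a f P Q B"
  shows "filling_cert N a d"
proof -
  obtain g where g: "bij_betw g {..<card P} P"
    using ex_bij_betw_nat_finite[OF fin(1)] unfolding atLeast0LessThan by blast
  obtain h where h: "bij_betw h {..<card Q} Q"
    using ex_bij_betw_nat_finite[OF fin(2)] unfolding atLeast0LessThan by blast
  show ?thesis
    unfolding filling_cert_def
    by (intro exI conjI allI impI) (use assms(1-3) card mult_inj_reindex[OF inj g h] in auto)
qed

text \<open>Slope 1: the pencil is the identity, coming from \<open>f 0 = 1\<close>. This is one of
  the two ends of the descent by reflections.\<close>

lemma cert_degree_0:
  assumes "0 < N" shows "filling_cert N a 0"
proof (rule certI[where f = "\<lambda>_. 1" and P = "{()}" and Q = "{()}" and B = "\<lambda>i _ _. if i = 0 then 1 else 0"])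
  have "(\<Sum>i<N. smult (if i = 0 then 1 else 0) (1 :: complex poly)) = (\<Sum>i<N. if i = 0 then 1 else 0)"
    by (rule sum.cong) auto
  also have "\<dots> = 1" using assms by simp
  finally show "mult_inj N a (\<lambda>_. 1) {()} {()} (\<lambda>i _ _. if i = 0 then 1 else 0)"
    by (simp add: mult_inj_def)
qed auto

text \<open>The other end of the descent: the source is the zero space, so one column and no rows
  suffice.\<close>

lemma cert_0:
  assumes "2 \<le> N" shows "filling_cert N 0 d"
proof (rule certI[where f = "\<lambda>i. if i = 0 then 1 else monom 1 d" and P = "{} :: unit set" and Q = "{()}"
      and B = "\<lambda>_ _ _. 0"])
  show "mult_inj N 0 (\<lambda>i. if i = 0 then 1 else monom 1 d) ({} :: unit set) {()} (\<lambda>_ _ _. 0)"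
    by (simp add: mult_inj_def low_deg_0_iff)
qed (use assms in \<open>auto simp: degree_monom_eq\<close>)

section \<open>Shifts and reflections of certificates\<close>

lemma low_deg_split:
  assumes "low_deg a p" "p + monom 1 a * g = 0"
  shows "p = 0 \<and> g = 0"
proof -
  have eq: "coeff p n + (if n < a then 0 else coeff g (n - a)) = 0" for n
    using arg_cong[OF assms(2), of "\<lambda>p. coeff p n"]
    by (auto simp: coeff_monom_mult split: if_splits)
  have "coeff p n = 0" for n
    using eq[of n] assms(1) by (cases "n < a") (auto simp: low_deg_def)
  moreover have "coeff g n = 0" for n
    using eq[of "n + a"] assms(1) by (simp add: low_deg_def)
  ultimately show ?thesis by (simp add: poly_eq_iff)
qed

text \<open>Uniqueness of the expansion in base \<open>u^a\<close>, by splitting off the lowest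
  digit.\<close>

lemma low_deg_digits:
  assumes "\<And>i. i < M \<Longrightarrow> low_deg a (z i)" "(\<Sum>i<M. monom 1 (i * a) * z i) = 0" "i < M"
  shows "z i = 0"
  using assms
proof (induction M arbitrary: z i)
  case (Suc M)
  have "z 0 + monom 1 a * (\<Sum>i<M. monom 1 (i * a) * z (Suc i)) = 0"
    using Suc.prems(2) unfolding sum.lessThan_Suc_shift
    by (simp add: sum_distrib_left mult_monom mult.assoc[symmetric] flip: one_poly_eq_simps)
  then have "z 0 = 0" "(\<Sum>i<M. monom 1 (i * a) * z (Suc i)) = 0"
    using low_deg_split[of a "z 0"] Suc.prems(1)[of 0] by auto
  then show ?case
    using Suc.IH[of "\<lambda>i. z (Suc i)" "i - 1"] Suc.prems by (cases i) auto
qed simp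

text \<open>The subspace \<open>\<langle>1\<rangle> \<oplus> u\<^sup>a V\<close>: multiplication by \<open>1\<close> and by \<open>u\<^sup>a V\<close> have independent images.\<close>
lemma cert_shift:
  assumes "filling_cert N a d" "0 < N"
  shows "filling_cert (Suc N) a (a + d)"
proof -
  obtain f p q B where f: "f 0 = 1" "coeff (f (N - 1)) d \<noteq> 0" "\<And>i. i < N \<Longrightarrow> degree (f i) \<le> d"
    and q: "0 < q" "p * (a + d) \<le> q * a"
    and inj: "mult_inj N a f {..<p} {..<q} (B :: nat \<Rightarrow> nat \<Rightarrow> nat \<Rightarrow> complex)"
    using assms(1) unfolding filling_cert_def by blast
  define f' where "f' i = (case i of 0 \<Rightarrow> 1 | Suc i \<Rightarrow> monom 1 a * f i)" for i
  \<comment> \<open>The new pencil is the block row \<open>[u^a G | I]\<close>: the columns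
    \<open>Inl\<close> carry the old pencil \<open>G\<close>, the columns \<open>Inr\<close> the
    identity on \<open>f' 0 = 1\<close>.\<close>
  define B' where "B' i r c = (case c of Inl c \<Rightarrow> (case i of 0 \<Rightarrow> 0 | Suc i \<Rightarrow> B i r c)
      | Inr s \<Rightarrow> (if i = 0 \<and> s = r then 1 else 0))" for i r and c :: "nat + nat"
  show ?thesis
  proof (rule certI[where f = f' and P = "{..<p}" and Q = "{..<q} <+> {..<p}" and B = B'])
    show "coeff (f' (Suc N - 1)) (a + d) \<noteq> 0"
      using f(2) assms(2) by (cases N) (simp_all add: f'_def coeff_monom_mult)
    show "degree (f' i) \<le> a + d" if "i < Suc N" for i
      using f(3) that degree_mult_le[of "monom 1 a"]
      by (cases i) (auto simp: f'_def degree_monom_eq intro: order_trans[OF degree_mult_le])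
    show "card {..<p} * (a + (a + d)) \<le> card ({..<q} <+> {..<p}) * a"
      using q by (simp add: card_Plus algebra_simps)
    show "mult_inj (Suc N) a f' {..<p} ({..<q} <+> {..<p}) B'"
      unfolding mult_inj_def
    proof (intro allI impI)
      fix \<phi> :: "nat + nat \<Rightarrow> complex poly"
      assume low: "\<forall>c\<in>{..<q} <+> {..<p}. low_deg a (\<phi> c)"
        and eq: "\<forall>r\<in>{..<p}. (\<Sum>c\<in>{..<q} <+> {..<p}. (\<Sum>i<Suc N. smult (B' i r c) (f' i)) * \<phi> c) = 0"
      have l: "(\<Sum>i<Suc N. smult (B' i r (Inl c)) (f' i)) = monom 1 a * (\<Sum>i<N. smult (B i r c) (f i))" for r c
        unfolding sum.lessThan_Suc_shift by (simp add: B'_def f'_def sum_distrib_left)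
      have r: "(\<Sum>i<Suc N. smult (B' i r (Inr s)) (f' i)) = (if s = r then 1 else 0)" for r s
        unfolding sum.lessThan_Suc_shift by (simp add: B'_def f'_def)
      have "\<phi> (Inr r) = 0 \<and> (\<Sum>c<q. (\<Sum>i<N. smult (B i r c) (f i)) * \<phi> (Inl c)) = 0" if "r < p" for r
      proof (rule low_deg_split)
        define G where "G c = (\<Sum>i<N. smult (B i r c) (f i))" for c
        show "low_deg a (\<phi> (Inr r))" using low that by auto
        have "0 = (\<Sum>c<q. monom 1 a * G c * \<phi> (Inl c))
            + (\<Sum>s<p. (if s = r then 1 else 0) * \<phi> (Inr s))"
          using eq[rule_format, of r] that by (simp add: sum.Plus l r G_def del: sum.lessThan_Suc)
        also have "(\<Sum>s<p. (if s = r then 1 else 0) * \<phi> (Inr s)) = \<phi> (Inr r)"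
          using that by (simp add: if_distrib[of "\<lambda>x. x * _"] cong: if_cong)
        finally show "\<phi> (Inr r) + monom 1 a * (\<Sum>c<q. (\<Sum>i<N. smult (B i r c) (f i)) * \<phi> (Inl c)) = 0"
          unfolding G_def[symmetric] by (simp add: sum_distrib_left mult.assoc add.commute)
      qed
      moreover have "\<forall>c\<in>{..<q}. low_deg a (\<phi> (Inl c))" using low by auto
      ultimately have "\<forall>c\<in>{..<q}. \<phi> (Inl c) = 0" "\<forall>r<p. \<phi> (Inr r) = 0"
        using inj[unfolded mult_inj_def, rule_format, of "\<lambda>c. \<phi> (Inl c)"] by auto
      then show "\<forall>c\<in>{..<q} <+> {..<p}. \<phi> c = 0" by auto
    qed
  qed (use q f in \<open>auto simp: card_Plus f'_def\<close>)
qed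

text \<open>This realises the reflection functor on Kronecker modules inside polynomials: for
  \<open>V = \<langle>1, u\<^sup>a, \<dots>, u\<^bsup>(M-1)a\<^esup>, G\<rangle>\<close> with \<open>G = \<Sum>i<M. u\<^bsup>ia\<^esup> f\<^bsub>i+1\<^esub>\<close>, the relations \<open>\<Sum>i. v\<^sub>i z\<^sub>i = 0\<close> with
  \<open>deg z\<^sub>i < a\<close> are exactly \<open>z\<^sub>M = y\<close>, \<open>z\<^sub>i = - f\<^bsub>i+1\<^esub> y\<close> with \<open>deg y < a'\<close>.\<close>
lemma reflection_relations:
  assumes a: "a = a' + r" and f: "\<And>i. i \<le> M \<Longrightarrow> degree (f i) \<le> r" "coeff (f M) r \<noteq> 0" and M: "0 < M"
    and G: "G = (\<Sum>i<M. monom 1 (i * a) * f (Suc i))"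
    and low: "\<And>i. i \<le> M \<Longrightarrow> low_deg a (z i)"
    and rel: "(\<Sum>i<M. monom 1 (i * a) * z i) + G * z M = 0"
    and coG: "coeff G ((M - 1) * a + r) \<noteq> 0"
  shows "low_deg a' (z M) \<and> (\<forall>i<M. z i = - f (Suc i) * z M)"
proof
  have eq: "G * z M = - (\<Sum>i<M. monom 1 (i * a) * z i)"
    using rel by (simp add: eq_neg_iff_add_eq_0 add.commute)
  have le: "Suc i * a \<le> M * a" if "i < M" for i
    using that by (intro mult_le_mono1) simp
  have "low_deg (M * a) (monom 1 (i * a) * z i)" if "i < M" for i
  proof -
    have "low_deg (a + i * a) (monom 1 (i * a) * z i)"
      using that low by (intro low_deg_mult) (auto simp: degree_monom_eq)
    then show ?thesis using le[OF that] by (auto simp: low_deg_def)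
  qed
  then have lowG: "low_deg (M * a) (G * z M)"
    unfolding eq by (intro low_deg_uminus low_deg_sum) auto
  \<comment> \<open>\<open>G\<close> has degree at least \<open>(M - 1) * a + r\<close> and
    \<open>G * z M\<close> degree below \<open>M * a\<close>, which leaves degree below
    \<open>a - r = a'\<close> for \<open>z M\<close>.\<close>
  show lowz: "low_deg a' (z M)"
  proof (cases "z M = 0")
    case False
    have "G \<noteq> 0" using coG by auto
    then have "(M - 1) * a + r + degree (z M) \<le> degree (G * z M)"
      using le_degree[OF coG] False by (simp add: degree_mult_eq)
    also have "\<dots> < M * a" using low_deg_degree[OF lowG] False \<open>G \<noteq> 0\<close> by simp
    finally have "degree (z M) < a'" using M a by (cases M) auto
    then show ?thesis by (rule low_degI_degree)
  qed simp
  \<comment> \<open>The bound on \<open>z M\<close> puts \<open>f (Suc i) * z M\<close> below degree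
    \<open>a' + r = a\<close>, so these sums are digits in base \<open>u^a\<close>.\<close>
  have "z i + f (Suc i) * z M = 0" if "i < M" for i
  proof (rule low_deg_digits[OF _ _ that])
    show "low_deg a (z i + f (Suc i) * z M)" if "i < M" for i
      unfolding a using that low[of i] a low_deg_mult[OF f(1) lowz, of "Suc i"]
      by (intro low_deg_add) auto
    show "(\<Sum>i<M. monom 1 (i * a) * (z i + f (Suc i) * z M)) = 0"
      using rel by (simp add: G distrib_left sum.distrib sum_distrib_right mult.assoc)
  qed
  then show "\<forall>i<M. z i = - f (Suc i) * z M"
    by (simp add: eq_neg_iff_add_eq_0)
qed

text \<open>Takes the pair \<open>(a', a)\<close> to \<open>(a, N * a - a')\<close>. The new
  matrices come from the kernel of the old ones placed side by side, of dimension at least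
  \<open>N * q - p\<close>; \<open>reflection_relations\<close> converts a tuple killed by the new
  pencil into one killed by the old.\<close>

lemma cert_reflection:
  assumes cert: "filling_cert N a' r" and N: "2 \<le> N" and a: "a = a' + r" "0 < a"
  shows "filling_cert N a ((N - 2) * a + r)"
proof -
  define M where "M = N - 1"
  have M: "N = Suc M" "0 < M" using N by (auto simp: M_def)
  obtain f p q B where f: "f 0 = 1" "coeff (f M) r \<noteq> 0" "\<And>i. i < N \<Longrightarrow> degree (f i) \<le> r"
    and q: "0 < q" "p * (a' + r) \<le> q * a'"
    and inj: "mult_inj N a' f {..<p} {..<q} (B :: nat \<Rightarrow> nat \<Rightarrow> nat \<Rightarrow> complex)"
    using cert unfolding filling_cert_def M_def by blast
  define G where "G = (\<Sum>i<M. monom 1 (i * a) * f (Suc i))"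
  let ?d = "(M - 1) * a + r"
  define g where "g i = (if i < M then monom 1 (i * a) else G)" for i
  \<comment> \<open>The signs match the relations \<open>z M = y\<close>,
    \<open>z i = - f (Suc i) * y\<close>: on these, \<open>E\<close> acts as the old pencil does on
    \<open>y\<close>.\<close>
  define E where "E r = (\<lambda>(i, c). if i = M then B 0 r c else - B (Suc i) r c)" for r
  obtain n K where n: "card ({..<N} \<times> {..<q}) \<le> n + card {..<p}"
    and K: "\<forall>r\<in>{..<p}. \<forall>t<n. (\<Sum>j\<in>{..<N} \<times> {..<q}. E r j * K j t) = 0"
    and Kinj: "\<forall>v. (\<forall>j\<in>{..<N} \<times> {..<q}. (\<Sum>t<n. K j t * v t) = 0) \<longrightarrow> (\<forall>t<n. v t = (0 :: complex))"
    using kernel_basis[of "{..<p}" "{..<N} \<times> {..<q}" E] by auto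
  have term_deg: "degree (monom 1 (i * a) * f (Suc i)) \<le> i * a + r" if "i < M" for i
    using f(3)[of "Suc i"] that M by (intro order_trans[OF degree_mult_le]) (simp add: degree_monom_eq)
  have le: "i * a \<le> (M - 1) * a" if "i < M" for i
    using that by (intro mult_le_mono1) simp
  have degG: "degree G \<le> ?d"
    unfolding G_def
    by (intro degree_sum_le finite_lessThan order_trans[OF term_deg add_right_mono[OF le]]) auto
  have coG: "coeff G ?d \<noteq> 0"
  proof -
    have "coeff (monom 1 (i * a) * f (Suc i)) ?d = 0" if "i < M" "i \<noteq> M - 1" for i
    proof -
      have "i < M - 1" using that by simp
      then have "i * a + r < ?d" using \<open>0 < a\<close> by simp
      then show ?thesis by (rule coeff_eq_0[OF le_less_trans[OF term_deg[OF that(1)]]])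
    qed
    then have "coeff G ?d = (\<Sum>i<M. if i = M - 1 then coeff (f M) r else 0)"
      unfolding G_def coeff_sum using M(2) by (intro sum.cong) (auto simp: coeff_monom_mult)
    then show ?thesis using f(2) M by simp
  qed
  have count: "q * (a + ?d) \<le> n * a"
  proof -
    have "N * q * a \<le> n * a + p * a"
      using mult_le_mono1[OF n, of a] by (simp add: algebra_simps)
    also have "p * a \<le> q * a'" using q(2) a(1) by simp
    finally have "N * q * a \<le> n * a + q * a'" by simp
    moreover have "N * q * a = q * (a + ?d) + q * a'"
      using M a(1) by (cases M) (auto simp: algebra_simps)
    ultimately show ?thesis by simp
  qed
  have "mult_inj N a g {..<q} {..<n} (\<lambda>i c t. K (i, c) t)"
    unfolding mult_inj_def
  proof (intro allI impI)
    fix \<psi> :: "nat \<Rightarrow> complex poly"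
    assume low: "\<forall>t\<in>{..<n}. low_deg a (\<psi> t)"
      and eq: "\<forall>c\<in>{..<q}. (\<Sum>t<n. (\<Sum>i<N. smult (K (i, c) t) (g i)) * \<psi> t) = 0"
    \<comment> \<open>\<open>z\<close> is \<open>K\<close> applied to \<open>\<psi>\<close>, so
      \<open>E\<close> annihilates it, and the vanishing of row \<open>c\<close> says that the
      \<open>z (i, c)\<close> form a relation between the \<open>g i\<close>.\<close>
    define z where "z j = (\<Sum>t<n. smult (K j t) (\<psi> t))" for j
    define y where "y c = z (M, c)" for c
    have lowz: "low_deg a (z j)" for j
      unfolding z_def using low by (intro low_deg_sum low_deg_smult) auto
    have rel: "low_deg a' (y c) \<and> (\<forall>i<M. z (i, c) = - f (Suc i) * y c)" if "c < q" for c
      unfolding y_def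
    proof (rule reflection_relations[where z = "\<lambda>i. z (i, c)", OF a(1) _ f(2) M(2) G_def lowz _ coG])
      have "(\<Sum>t<n. (\<Sum>i<N. smult (K (i, c) t) (g i)) * \<psi> t) = (\<Sum>t<n. \<Sum>i<N. g i * smult (K (i, c) t) (\<psi> t))"
        by (simp add: sum_distrib_right)
      also have "\<dots> = (\<Sum>i<N. \<Sum>t<n. g i * smult (K (i, c) t) (\<psi> t))"
        by (rule sum.swap)
      also have "\<dots> = (\<Sum>i<N. g i * z (i, c))"
        by (simp only: z_def sum_distrib_left)
      also have "\<dots> = (\<Sum>i<M. monom 1 (i * a) * z (i, c)) + G * z (M, c)"
        by (simp add: M g_def)
      finally show "(\<Sum>i<M. monom 1 (i * a) * z (i, c)) + G * z (M, c) = 0"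
        using eq that by simp
    qed (use f(3) M in auto)
    have "(\<Sum>c<q. (\<Sum>i<N. smult (B i r c) (f i)) * y c) = 0" if "r < p" for r
    proof -
      have "(\<Sum>i<N. smult (B i r c) (f i)) * y c = (\<Sum>i<N. smult (E r (i, c)) (z (i, c)))" if "c < q" for c
      proof -
        have "(\<Sum>i<N. smult (B i r c) (f i)) * y c =
            smult (B 0 r c) (y c) + (\<Sum>i<M. smult (B (Suc i) r c) (f (Suc i) * y c))"
          unfolding M(1) sum.lessThan_Suc_shift by (simp add: f(1) distrib_right sum_distrib_right)
        also have "(\<Sum>i<M. smult (B (Suc i) r c) (f (Suc i) * y c)) = (\<Sum>i<M. smult (E r (i, c)) (z (i, c)))"
          using rel[OF that] by (intro sum.cong) (auto simp: E_def)
        also have "smult (B 0 r c) (y c) = smult (E r (M, c)) (z (M, c))"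
          by (simp add: E_def y_def)
        finally show ?thesis by (simp add: M(1) add.commute)
      qed
      then have "(\<Sum>c<q. (\<Sum>i<N. smult (B i r c) (f i)) * y c) = (\<Sum>c<q. \<Sum>i<N. smult (E r (i, c)) (z (i, c)))"
        by simp
      also have "\<dots> = (\<Sum>i<N. \<Sum>c<q. smult (E r (i, c)) (z (i, c)))"
        by (rule sum.swap)
      also have "\<dots> = (\<Sum>j\<in>{..<N} \<times> {..<q}. smult (E r j) (z j))"
        using sum.cartesian_product[of "\<lambda>i c. smult (E r (i, c)) (z (i, c))" "{..<q}" "{..<N}"]
        by (simp add: case_prod_unfold)
      also have "\<dots> = (\<Sum>j\<in>{..<N} \<times> {..<q}. \<Sum>t<n. smult (E r j * K j t) (\<psi> t))"
        by (simp add: z_def pvs.scale_sum_right)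
      also have "\<dots> = (\<Sum>t<n. \<Sum>j\<in>{..<N} \<times> {..<q}. smult (E r j * K j t) (\<psi> t))"
        by (rule sum.swap)
      also have "\<dots> = (\<Sum>t<n. smult (\<Sum>j\<in>{..<N} \<times> {..<q}. E r j * K j t) (\<psi> t))"
        by (simp only: pvs.scale_sum_left)
      also have "\<dots> = 0" using K \<open>r < p\<close> by simp
      finally show ?thesis .
    qed
    then have y0: "\<forall>c\<in>{..<q}. y c = 0"
      using inj[unfolded mult_inj_def, rule_format, of y] rel by blast
    have z0: "z (i, c) = 0" if "i < N" "c < q" for i c
      using rel[OF that(2)] y0 that M(1) by (cases "i = M") (auto simp: y_def)
    \<comment> \<open>All \<open>z\<close> vanish, so independence of the columns of
      \<open>K\<close>, used coefficientwise, removes \<open>\<psi>\<close>.\<close>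
    have "coeff (\<psi> t) k = 0" if "t < n" for t k
    proof -
      have "(\<Sum>t<n. K j t * coeff (\<psi> t) k) = 0" if "j \<in> {..<N} \<times> {..<q}" for j
      proof -
        have "(\<Sum>t<n. K j t * coeff (\<psi> t) k) = coeff (z j) k" by (simp add: z_def coeff_sum)
        then show ?thesis using z0 that by auto
      qed
      then show ?thesis using Kinj[rule_format, of "\<lambda>t. coeff (\<psi> t) k" t] that by blast
    qed
    then show "\<forall>t\<in>{..<n}. \<psi> t = 0" by (simp add: poly_eq_iff)
  qed
  moreover have "0 < n" using count q(1) \<open>0 < a\<close> by (cases n) auto
  moreover have "g 0 = 1" using M by (simp add: g_def)
  moreover have "degree (g i) \<le> ?d" if "i < N" for i
  proof (cases "i < M")
    case True
    then show ?thesis using trans_le_add1[OF le[OF True], of r] by (simp add: g_def degree_monom_eq)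
  next
    case False
    then show ?thesis using degG by (simp add: g_def)
  qed
  ultimately have "filling_cert N a ?d"
    using count coG by (intro certI[where f = g and P = "{..<q}" and Q = "{..<n}"]) (auto simp: M(1) g_def)
  then show ?thesis by (simp add: M(1))
qed

section \<open>Certificates from monomials\<close>

text \<open>Finds the only residue \<open>g\<close> that a shift by \<open>e\<close> carries to the
  class of \<open>y + s\<close>. Passing to integers avoids truncated subtraction.\<close>

lemma add_mod_eq_iff:
  fixes e y s b g :: nat
  assumes "e \<le> y" "g < b"
  shows "(g + e) mod b = (y + s) mod b \<longleftrightarrow> g = (y - e + s) mod b"
proof -
  have "(g + e) mod b = (y + s) mod b \<longleftrightarrow> int b dvd int (g + e) - int (y + s)"
    by (metis mod_eq_dvd_iff of_nat_eq_iff zmod_int)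
  also have "int (g + e) - int (y + s) = int g - int (y - e + s)"
    using assms(1) by simp
  also have "int b dvd int g - int (y - e + s) \<longleftrightarrow> g mod b = (y - e + s) mod b"
    by (metis mod_eq_dvd_iff of_nat_eq_iff zmod_int)
  finally show ?thesis using assms(2) by simp
qed

text \<open>A certificate for spans of monomials \<open>u\<^bsup>e i\<^esup>\<close> from an assignment of shifts: the copies of \<open>S\<^bsub>a-1\<^esub>\<close>
  are graded by \<open>\<int>/b\<close>, so that the pencil splits into \<open>b\<close> blocks. In the block of \<open>s\<close> the coefficient
  of \<open>u\<^sup>x\<close> only meets the matrices \<open>B i\<close> in degree \<open>x + s\<close>. These are independent for different \<open>x\<close>,
  hence the assignment turns the block into an injective one, and generic coefficients do this for all blocks.\<close>
lemma cert_monomials: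
  fixes e :: "nat \<Rightarrow> nat" and h :: "nat \<Rightarrow> nat \<Rightarrow> nat"
  assumes a: "0 < a" and N: "0 < N"
    and e: "e 0 = 0" "e (N - 1) = d" "\<And>i. i < N \<Longrightarrow> e i \<le> d"
    and h: "\<And>x k. x < a \<Longrightarrow> k < a + d \<Longrightarrow> h x k \<in> e ` {..<N}"
    and flow: "\<And>y. card {(x, k). x < a \<and> k < a + d \<and> x + h x k = y} \<le> a"
  shows "filling_cert N a d"
proof -
  define b where "b = a + d"
  let ?J = "{..<a} \<times> {..<b}"
  have "\<forall>x k. \<exists>i. (x, k) \<in> ?J \<longrightarrow> i < N \<and> e i = h x k"
    using h unfolding b_def by (fastforce simp: image_iff)
  then obtain idx where idx: "\<And>x k. (x, k) \<in> ?J \<Longrightarrow> idx x k < N \<and> e (idx x k) = h x k"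
    by metis
  \<comment> \<open>The cells sent to degree \<open>y\<close>. By \<open>flow\<close> there are at
    most \<open>a\<close> of them, so they can receive distinct row labels below
    \<open>a\<close>.\<close>
  define T where "T y = {(x, k). x < a \<and> k < b \<and> x + h x k = y}" for y
  have "\<exists>g. g ` T y \<subseteq> {..<a} \<and> inj_on g (T y)" for y
  proof (rule card_le_inj)
    have "T y \<subseteq> ?J" by (auto simp: T_def)
    then show "finite (T y)" by (rule finite_subset) simp
    show "card (T y) \<le> card {..<a}" using flow[of y] by (simp add: T_def b_def)
  qed simp
  then obtain g where g: "\<And>y. g y ` T y \<subseteq> {..<a}" "\<And>y. inj_on (g y) (T y)" by metis
  define tgt where "tgt x k = g (x + h x k) (x, k)" for x k
  have tgt: "tgt x k < a" if "(x, k) \<in> ?J" for x k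
  proof -
    have "(x, k) \<in> T (x + h x k)" using that by (simp add: T_def)
    then show ?thesis using g(1)[of "x + h x k"] unfolding tgt_def by blast
  qed
  have tgt_inj: "x = x' \<and> k = k'"
    if "(x, k) \<in> ?J" "(x', k') \<in> ?J" "x + h x k = x' + h x' k'" "tgt x k = tgt x' k'" for x k x' k'
    using inj_onD[OF g(2)[of "x + h x k"], of "(x, k)" "(x', k')"] that
    by (auto simp: tgt_def T_def)
  \<comment> \<open>The matrix of block \<open>s\<close>: column \<open>(x, k)\<close> is the
    coefficient of \<open>u^x\<close> in copy \<open>((x + s) mod b, k)\<close>, row
    \<open>(y, r)\<close> that of \<open>u^y\<close> in output
    \<open>((y + s) mod b, r)\<close>.\<close>
  define A where "A s \<beta> rw cl = (\<Sum>i<N. if fst cl + e i = fst rw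
      then \<beta> (i, (fst cl + s) mod b, snd rw, snd cl) else 0)"
    for s and \<beta> :: "nat \<times> nat \<times> nat \<times> nat \<Rightarrow> complex" and rw cl :: "nat \<times> nat"
  define good where "good s \<beta> \<longleftrightarrow> (\<forall>v. (\<forall>rw\<in>UNIV \<times> {..<a}. (\<Sum>cl\<in>?J. A s \<beta> rw cl * v cl) = 0) \<longrightarrow>
      (\<forall>cl\<in>?J. v cl = 0))" for s \<beta>
  have "\<exists>f. poly_fun UNIV f \<and> (\<exists>m. f m \<noteq> 0) \<and> (\<forall>\<beta>. f \<beta> \<noteq> 0 \<longrightarrow> good s \<beta>)" for s
  proof -
    \<comment> \<open>The 0-1 choice that follows the assignment. It is unambiguous because
      \<open>x < a \<le> b\<close> is determined by \<open>(x + s) mod b\<close>.\<close>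
    define \<beta>0 where "\<beta>0 = (\<lambda>(i, c, r, k). if \<exists>x<a. (x + s) mod b = c \<and> i = idx x k \<and> r = tgt x k
        then 1 else (0 :: complex))"
    have \<beta>0: "\<beta>0 (i, (x + s) mod b, r, k) = (if i = idx x k \<and> r = tgt x k then 1 else 0)"
      if "x < a" for i x r k
    proof -
      have "x' = x" if "(x' + s) mod b = (x + s) mod b" "x' < a" for x'
        using add_mod_eq_iff[of s "x + s" x' b 0] that \<open>x < a\<close> by (simp add: b_def)
      then show ?thesis using that unfolding \<beta>0_def by auto
    qed
    \<comment> \<open>Row \<open>(x + h x k, tgt x k)\<close> has a single nonzero entry, in column
      \<open>(x, k)\<close>, so these rows alone make the block injective.\<close>
    have A: "A s \<beta>0 (x + h x k, tgt x k) cl = (if cl = (x, k) then 1 else 0)"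
      if "(x, k) \<in> ?J" "cl \<in> ?J" for x k cl
    proof -
      obtain x' k' where cl: "cl = (x', k')" by force
      have "A s \<beta>0 (x + h x k, tgt x k) cl =
          (\<Sum>i<N. if i = idx x' k' then (if x' + h x' k' = x + h x k \<and> tgt x k = tgt x' k' then 1 else 0) else 0)"
        unfolding A_def cl using that idx[of x' k'] by (intro sum.cong) (auto simp: \<beta>0 cl)
      also have "\<dots> = (if x' + h x' k' = x + h x k \<and> tgt x k = tgt x' k' then 1 else 0)"
        using idx[of x' k'] that cl by simp
      also have "\<dots> = (if cl = (x, k) then 1 else 0)"
        using tgt_inj[of x k x' k'] that cl by auto
      finally show ?thesis .
    qed
    have "good s \<beta>0"
      unfolding good_def
    proof (intro allI impI ballI)
      fix v cl assume v: "\<forall>rw\<in>UNIV \<times> {..<a}. (\<Sum>cl\<in>?J. A s \<beta>0 rw cl * v cl) = 0" and "cl \<in> ?J"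
      then obtain x k where cl: "cl = (x, k)" "(x, k) \<in> ?J" by auto
      have "0 = (\<Sum>cl\<in>?J. A s \<beta>0 (x + h x k, tgt x k) cl * v cl)"
        using v tgt[OF cl(2)] by auto
      also have "\<dots> = (\<Sum>cl\<in>?J. if cl = (x, k) then v cl else 0)"
        by (rule sum.cong) (simp_all add: A[OF cl(2)])
      also have "\<dots> = v cl" using cl by simp
      finally show "v cl = 0" by simp
    qed
    moreover have "poly_fun UNIV (\<lambda>\<beta>. A s \<beta> rw cl)" for rw cl
      unfolding A_def
    proof (rule poly_fun_sum)
      fix i
      show "poly_fun UNIV (\<lambda>\<beta>. if fst cl + e i = fst rw then \<beta> (i, (fst cl + s) mod b, snd rw, snd cl) else 0)"
        by (cases "fst cl + e i = fst rw") (simp_all add: pf_var pf_const)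
    qed
    ultimately show ?thesis
      using injectivity_open[of ?J "UNIV \<times> {..<a}" UNIV "A s" \<beta>0] unfolding good_def by auto
  qed
  then obtain F where F: "\<And>s. poly_fun UNIV (F s)" "\<And>s. \<exists>m. F s m \<noteq> 0" "\<And>s \<beta>. F s \<beta> \<noteq> 0 \<Longrightarrow> good s \<beta>"
    by metis
  obtain \<beta> where "\<forall>s\<in>{..<b}. F s \<beta> \<noteq> 0"
    using poly_fun_common_nonzero[of "{..<b}" UNIV F] F(1,2) by auto
  then have good: "good s \<beta>" if "s < b" for s using F(3) that by auto
  define f where "f i = (monom 1 (e i) :: complex poly)" for i
  \<comment> \<open>Multiplication by \<open>u^(e i)\<close> raises the class by \<open>e i\<close>
    modulo \<open>b\<close>; only entries respecting this grading are kept.\<close>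
  define B where "B i r c = (if (fst c + e i) mod b = fst r then \<beta> (i, fst c, snd r, snd c) else 0)"
    for i and r c :: "nat \<times> nat"
  show ?thesis
  proof (rule certI[where f = f and P = "{..<b} \<times> {..<a}" and Q = "{..<b} \<times> {..<b}" and B = B])
    show "mult_inj N a f ({..<b} \<times> {..<a}) ({..<b} \<times> {..<b}) B"
      unfolding mult_inj_def
    proof (intro allI impI)
      fix \<phi> :: "nat \<times> nat \<Rightarrow> complex poly"
      assume low: "\<forall>c\<in>{..<b} \<times> {..<b}. low_deg a (\<phi> c)"
        and eq: "\<forall>r\<in>{..<b} \<times> {..<a}. (\<Sum>c\<in>{..<b} \<times> {..<b}. (\<Sum>i<N. smult (B i r c) (f i)) * \<phi> c) = 0"
      have b0: "0 < b" using a by (simp add: b_def)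
      have zero: "\<forall>cl\<in>?J. coeff (\<phi> ((fst cl + s) mod b, snd cl)) (fst cl) = 0" if s: "s < b" for s
      proof -
        let ?v = "\<lambda>cl. coeff (\<phi> ((fst cl + s) mod b, snd cl)) (fst cl)"
        have "(\<Sum>cl\<in>?J. A s \<beta> (y, r) cl * ?v cl) = 0" if r: "r < a" for y r
        proof -
          let ?t = "\<lambda>i k. if e i \<le> y then \<beta> (i, (y - e i + s) mod b, r, k) * coeff (\<phi> ((y - e i + s) mod b, k)) (y - e i) else 0"
          have 1: "(\<Sum>x<a. (if x + e i = y then \<beta> (i, (x + s) mod b, r, k) else 0) * ?v (x, k)) = ?t i k"
            if "k < b" for i k
          proof (cases "e i \<le> y \<and> y - e i < a")
            case True
            then have "(\<Sum>x<a. (if x + e i = y then \<beta> (i, (x + s) mod b, r, k) else 0) * ?v (x, k)) =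
                (\<Sum>x<a. if x = y - e i then \<beta> (i, (x + s) mod b, r, k) * ?v (x, k) else 0)"
              by (intro sum.cong) auto
            then show ?thesis using True by simp
          next
            case False
            then have "(\<Sum>x<a. (if x + e i = y then \<beta> (i, (x + s) mod b, r, k) else 0) * ?v (x, k)) = 0"
              by (intro sum.neutral) auto
            moreover have "?t i k = 0"
              using False low that b0 by (auto simp: low_deg_def)
            ultimately show ?thesis by simp
          qed
          have 2: "(\<Sum>c<b. B i ((y + s) mod b, r) (c, k) * coeff (f i * \<phi> (c, k)) y) = ?t i k" for i k
          proof (cases "e i \<le> y")
            case True
            have "(\<Sum>c<b. B i ((y + s) mod b, r) (c, k) * coeff (f i * \<phi> (c, k)) y) =
                (\<Sum>c<b. if c = (y - e i + s) mod b then \<beta> (i, c, r, k) * coeff (\<phi> (c, k)) (y - e i) else 0)"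
              using True add_mod_eq_iff[OF True, of _ b s]
              by (intro sum.cong) (auto simp: B_def f_def coeff_monom_mult)
            then show ?thesis using True b0 by simp
          next
            case False
            then show ?thesis by (simp add: f_def coeff_monom_mult)
          qed
          have "(\<Sum>cl\<in>?J. A s \<beta> (y, r) cl * ?v cl) = (\<Sum>x<a. \<Sum>k<b. A s \<beta> (y, r) (x, k) * ?v (x, k))"
            by (simp add: sum.cartesian_product case_prod_unfold)
          also have "\<dots> = (\<Sum>x<a. \<Sum>k<b. \<Sum>i<N. (if x + e i = y then \<beta> (i, (x + s) mod b, r, k) else 0) * ?v (x, k))"
            by (simp add: A_def sum_distrib_right cong: if_cong)
          also have "\<dots> = (\<Sum>k<b. \<Sum>x<a. \<Sum>i<N. (if x + e i = y then \<beta> (i, (x + s) mod b, r, k) else 0) * ?v (x, k))"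
            by (rule sum.swap)
          also have "\<dots> = (\<Sum>k<b. \<Sum>i<N. \<Sum>x<a. (if x + e i = y then \<beta> (i, (x + s) mod b, r, k) else 0) * ?v (x, k))"
            by (intro sum.cong[OF refl] sum.swap)
          also have "\<dots> = (\<Sum>k<b. \<Sum>i<N. ?t i k)"
            using 1 by (intro sum.cong[OF refl]) auto
          also have "\<dots> = (\<Sum>k<b. \<Sum>i<N. \<Sum>c<b. B i ((y + s) mod b, r) (c, k) * coeff (f i * \<phi> (c, k)) y)"
            by (simp only: 2)
          also have "\<dots> = (\<Sum>k<b. \<Sum>c<b. \<Sum>i<N. B i ((y + s) mod b, r) (c, k) * coeff (f i * \<phi> (c, k)) y)"
            by (intro sum.cong[OF refl] sum.swap)
          also have "\<dots> = (\<Sum>c<b. \<Sum>k<b. \<Sum>i<N. B i ((y + s) mod b, r) (c, k) * coeff (f i * \<phi> (c, k)) y)"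
            by (rule sum.swap)
          also have "\<dots> = (\<Sum>c<b. \<Sum>k<b. coeff ((\<Sum>i<N. smult (B i ((y + s) mod b, r) (c, k)) (f i)) * \<phi> (c, k)) y)"
            by (simp add: coeff_sum sum_distrib_right)
          also have "\<dots> = coeff (\<Sum>c\<in>{..<b} \<times> {..<b}. (\<Sum>i<N. smult (B i ((y + s) mod b, r) c) (f i)) * \<phi> c) y"
            by (simp add: coeff_sum sum.cartesian_product case_prod_unfold)
          also have "\<dots> = 0" using eq r b0 by simp
          finally show ?thesis .
        qed
        then have "\<forall>rw\<in>UNIV \<times> {..<a}. (\<Sum>cl\<in>?J. A s \<beta> rw cl * ?v cl) = 0" by auto
        then show ?thesis using good[OF s, unfolded good_def, THEN spec[of _ ?v]] by blast
      qed
      have co: "coeff (\<phi> (c, k)) x = 0" if "c < b" "k < b" "x < a" for c k x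
      proof -
        \<comment> \<open>The block containing this coefficient is \<open>c - x\<close> modulo
          \<open>b\<close>; adding \<open>b\<close> keeps the subtraction from truncating.\<close>
        define s where "s = (c + b - x) mod b"
        have "x < b" using that by (simp add: b_def)
        then have "(x + s) mod b = c"
          using that(1) by (simp add: s_def mod_add_right_eq)
        moreover have "s < b" using b0 by (simp add: s_def)
        ultimately show ?thesis using zero[of s] that by auto
      qed
      show "\<forall>c\<in>{..<b} \<times> {..<b}. \<phi> c = 0"
      proof
        fix c assume c: "c \<in> {..<b} \<times> {..<b}"
        have "coeff (\<phi> c) x = 0" for x
          using co[of "fst c" "snd c" x] low c by (cases "x < a") (auto simp: low_deg_def)
        then show "\<phi> c = 0" by (simp add: poly_eq_iff)
      qed
    qed
  qed (use a e in \<open>auto simp: f_def b_def degree_monom_eq card_cartesian_product\<close>)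
qed

text \<open>For \<open>a = c d + \<rho>\<close> the span of \<open>1, u\<^sup>\<rho>, u\<^sup>d\<close> works: of the \<open>a + d\<close> copies of \<open>x\<close>, send
  \<open>m x\<close> to \<open>x + \<rho>\<close>, \<open>n x\<close> to \<open>x + d\<close> and keep the others. The flow equation
  \<open>m y - m (y - \<rho>) + n y - n (y - d) = d\<close> is solved by a ramp \<open>m\<close> and a staircase \<open>n\<close> of step width \<open>d\<close>.\<close>
lemma cert_low_slope:
  assumes d: "0 < d" "d \<le> a" and N: "3 \<le> N \<or> N = 2 \<and> d dvd a"
  shows "filling_cert N a d"
proof -
  define \<rho> where "\<rho> = a mod d"
  define m where "m x = d - 1 - x" for x
  define n where "n x = (if x < \<rho> then x + 1 else \<rho> + d * (1 + (x - \<rho>) div d))" for x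
  \<comment> \<open>All interior exponents are \<open>\<rho>\<close>. For \<open>N = 2\<close> there
    are none, but then \<open>\<rho> = 0\<close>, which is \<open>e 0\<close>.\<close>
  define e where "e i = (if i = 0 then 0 else if i = N - 1 then d else \<rho>)" for i :: nat
  define h where "h x k = (if k < m x then \<rho> else if k < m x + n x then d else 0)" for x k :: nat
  have \<rho>: "\<rho> < d" "a = d * (a div d) + \<rho>" "0 < a div d"
    using d by (auto simp: \<rho>_def div_greater_zero_iff)
  have N2: "2 \<le> N" using N by auto
  have n_le: "n x \<le> a" if "x < a" for x
  proof (cases "x < \<rho>")
    case False
    then have "x - \<rho> < (a div d) * d" using that \<rho>(2) by (simp add: mult.commute)
    then have "(x - \<rho>) div d < a div d" using d(1) by (simp add: div_less_iff_less_mult)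
    then have "d * (1 + (x - \<rho>) div d) \<le> d * (a div d)" by (intro mult_le_mono2) simp
    then show ?thesis using False \<rho>(2) by (simp add: n_def)
  qed (use that in \<open>simp add: n_def\<close>)
  have mn_le: "m x + n x \<le> a + d" if "x < a" for x
    using n_le[OF that] by (simp add: m_def)
  \<comment> \<open>The flow equation written without subtraction: inflow plus \<open>d\<close>
    equals outflow. The guards drop contributions from negative degrees.\<close>
  have balance: "(if \<rho> \<le> y then m (y - \<rho>) else 0) + (if d \<le> y then n (y - d) else 0) + d = m y + n y" for y
  proof -
    consider "y < \<rho>" | "\<rho> \<le> y" "y < d" | "d \<le> y" "y < d + \<rho>" | "d + \<rho> \<le> y" by linarith
    then show ?thesis
    proof cases
      case 1
      then show ?thesis using \<rho>(1) by (simp add: m_def n_def)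
    next
      case 2
      then show ?thesis using \<rho>(1) by (simp add: m_def n_def)
    next
      case 3
      then have "y - \<rho> < d" "y - d < \<rho>" using d(1) by linarith+
      then show ?thesis using 3 \<rho>(1) by (simp add: m_def n_def)
    next
      case 4
      then have "(y - \<rho>) div d = 1 + (y - d - \<rho>) div d"
        using le_div_geq[OF d(1), of "y - \<rho>"] by (simp add: diff_diff_add add.commute)
      then show ?thesis using 4 \<rho>(1) by (simp add: m_def n_def)
    qed
  qed
  show ?thesis
  proof (rule cert_monomials[where e = e and h = h])
    show "h x k \<in> e ` {..<N}" for x k
    proof -
      have "0 \<in> e ` {..<N}" by (rule image_eqI[of _ _ 0]) (use N2 in \<open>auto simp: e_def\<close>)
      moreover have "d \<in> e ` {..<N}" by (rule image_eqI[of _ _ "N - 1"]) (use N2 in \<open>auto simp: e_def\<close>)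
      moreover have "\<rho> \<in> e ` {..<N}"
      proof (cases "N = 2")
        case True
        then show ?thesis using N \<open>0 \<in> e ` {..<N}\<close> by (simp add: \<rho>_def)
      next
        case False
        then show ?thesis using N by (intro image_eqI[of _ _ 1]) (auto simp: e_def)
      qed
      ultimately show ?thesis by (simp add: h_def)
    qed
    show "card {(x, k). x < a \<and> k < a + d \<and> x + h x k = y} \<le> a" for y
    proof -
      \<comment> \<open>\<open>X0\<close> collects the copies kept at \<open>y\<close>,
        \<open>X1\<close> and \<open>X2\<close> those arriving by the shifts \<open>\<rho>\<close>
        and \<open>d\<close>.\<close>
      define X0 where "X0 = (if y < a then Pair y ` {m y + n y..<a + d} else {})"
      define X1 where "X1 = (if \<rho> \<le> y then Pair (y - \<rho>) ` {..<m (y - \<rho>)} else {})"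
      define X2 where "X2 = (if d \<le> y \<and> y - d < a then Pair (y - d) ` {m (y - d)..<m (y - d) + n (y - d)} else {})"
      have "{(x, k). x < a \<and> k < a + d \<and> x + h x k = y} \<subseteq> X0 \<union> (X1 \<union> X2)"
      proof
        fix z assume "z \<in> {(x, k). x < a \<and> k < a + d \<and> x + h x k = y}"
        then obtain x k where z: "z = (x, k)" "x < a" "k < a + d" "x + h x k = y" by blast
        consider "k < m x" | "m x \<le> k" "k < m x + n x" | "m x + n x \<le> k" by linarith
        then show "z \<in> X0 \<union> (X1 \<union> X2)"
        proof cases
          case 1
          then have "y = x + \<rho>" using z by (simp add: h_def)
          then show ?thesis using 1 z by (simp add: X1_def)
        next
          case 2
          then have "y = x + d" using z by (simp add: h_def)
          then show ?thesis using 2 z by (simp add: X2_def)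
        next
          case 3
          then have "y = x" using z by (simp add: h_def)
          then show ?thesis using 3 z by (simp add: X0_def)
        qed
      qed
      then have "card {(x, k). x < a \<and> k < a + d \<and> x + h x k = y} \<le> card (X0 \<union> (X1 \<union> X2))"
        by (rule card_mono[rotated]) (auto simp: X0_def X1_def X2_def)
      also have "\<dots> \<le> card X0 + (card X1 + card X2)"
        using card_Un_le[of X0 "X1 \<union> X2"] card_Un_le[of X1 X2] by linarith
      also have "\<dots> \<le> a"
      proof -
        have "card X0 = (if y < a then a + d - (m y + n y) else 0)"
          by (simp add: X0_def card_image inj_on_def)
        moreover have "card X1 = (if \<rho> \<le> y then m (y - \<rho>) else 0)"
          by (simp add: X1_def card_image inj_on_def)
        moreover have "card X2 = (if d \<le> y \<and> y - d < a then n (y - d) else 0)"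
          by (simp add: X2_def card_image inj_on_def)
        ultimately show ?thesis
        proof (cases "y < a")
          case True
          then show ?thesis
            using \<open>card X0 = _\<close> \<open>card X1 = _\<close> \<open>card X2 = _\<close> balance[of y] mn_le[OF True]
            by (simp split: if_splits)
        next
          case False
          \<comment> \<open>From degree \<open>a\<close> on the ramp \<open>m\<close> contributes
            nothing, so only shifts by \<open>d\<close> arrive, at most
            \<open>n (y - d) \<le> a\<close> of them.\<close>
          have "d * 1 \<le> d * (a div d)" using \<rho>(3) by (intro mult_le_mono2) simp
          then have "d \<le> y - \<rho>" using False \<rho>(2) by linarith
          then have "m (y - \<rho>) = 0" by (simp add: m_def)
          then show ?thesis
            using False \<open>card X0 = _\<close> \<open>card X1 = _\<close> \<open>card X2 = _\<close> n_le[of "y - d"] by simp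
        qed
      qed
      finally show ?thesis .
    qed
  qed (use d N2 \<rho>(1) in \<open>auto simp: e_def\<close>)
qed

section \<open>Induction on N and descent by reflections\<close>

text \<open>Slopes up to 2 come from monomials; larger ones are reached by
  \<open>cert_shift\<close>, which raises \<open>N\<close> and the slope by one each. At
  \<open>N = 3\<close> the hypothesis forces \<open>d < a\<close>.\<close>

lemma cert_middle_slope:
  assumes "3 \<le> N" "0 < a" "a + d < (N - 1) * a"
  shows "filling_cert N a d"
  using assms
proof (induction N arbitrary: d rule: nat_induct_at_least)
  case base
  then show ?case using cert_degree_0[of 3 a] cert_low_slope[of d a 3] by (cases "d = 0") auto
next
  case (Suc N)
  show ?case
  proof (cases "d \<le> a")
    case True
    then show ?thesis
      using Suc.hyps cert_degree_0[of "Suc N" a] cert_low_slope[of d a "Suc N"] by (cases "d = 0") auto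
  next
    case False
    have "N * a = (N - 1) * a + a" using Suc.hyps by (cases N) auto
    then have "filling_cert N a (d - a)" using Suc False by auto
    from cert_shift[OF this] show ?thesis using False Suc.hyps by simp
  qed
qed

lemma theta_iter_bounds:
  assumes "2 \<le> N" shows "1 \<le> theta_iter N i \<and> theta_iter N i \<le> real N"
proof (induction i)
  case (Suc i)
  then have "0 < 1 / theta_iter N i" "1 / theta_iter N i \<le> 1" by (auto simp: divide_simps)
  moreover have "2 \<le> real N" using assms by simp
  ultimately show ?case unfolding theta_iter.simps by linarith
qed (use assms in simp)

text \<open>The quadratic form \<open>a\<^sup>2 + b\<^sup>2 - N a b\<close> is invariant under the reflection \<open>(a, b) \<mapsto> (N a - b, a)\<close>.\<close>
lemma cert_Psi:
  assumes N: "3 \<le> N" and a: "0 < a" "a \<le> b"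
    and ab: "a * a + b * b < N * a * b \<or> (\<exists>i. real b = theta_iter N i * real a)"
  shows "filling_cert N a (b - a)"
  using a ab
proof (induction a arbitrary: b rule: less_induct)
  case (less a)
  show ?case
  proof (cases "b < (N - 1) * a")
    case True
    then show ?thesis using cert_middle_slope[of N a "b - a"] N less.prems by simp
  next
    case False
    \<comment> \<open>Prepares \<open>a' = N * a - b\<close>, so that \<open>cert_reflection\<close>
      leads from \<open>(a', a)\<close> to \<open>(a, b)\<close>.\<close>
    define r where "r = b - (N - 1) * a"
    define a' where "a' = a - r"
    have b: "b = (N - 1) * a + r" using False by (simp add: r_def)
    have Na: "N * a = (N - 1) * a + a" "(N - 1) * a = (N - 2) * a + a"
    proof -
      obtain k where "N = k + 2" using N le_Suc_ex[of 2 N] by (auto simp: add.commute)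
      then show "N * a = (N - 1) * a + a" "(N - 1) * a = (N - 2) * a + a" by auto
    qed
    have "b \<le> N * a"
      using less.prems(3)
    proof
      assume "a * a + b * b < N * a * b"
      then have "b * b < N * a * b" by (rule le_less_trans[OF le_add2])
      then show ?thesis by simp
    next
      assume "\<exists>i. real b = theta_iter N i * real a"
      then obtain i where "real b = theta_iter N i * real a" by blast
      also have "\<dots> \<le> real N * real a"
        using theta_iter_bounds[of N i] N by (intro mult_right_mono) auto
      finally have "real b \<le> real (N * a)" by simp
      then show ?thesis by (simp only: of_nat_le_iff)
    qed
    then have r: "r \<le> a" using b Na(1) by simp
    then have a_eq: "a = a' + r" by (simp add: a'_def)
    have a'_eq: "a' + b = N * a" using a_eq b Na(1) by simp
    have "filling_cert N a' r"
    \<comment> \<open>The descent ends at \<open>b = N * a\<close> or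
      \<open>b = (N - 1) * a\<close>. Otherwise \<open>a' < a\<close>, and the induction hypothesis
      applies to \<open>(a', a)\<close>.\<close>
    proof (cases "a' = 0 \<or> r = 0")
      case True
      then show ?thesis using cert_0[of N r] cert_degree_0[of N a'] N by auto
    next
      case False
      have "a' * a' + a * a < N * a' * a \<or> (\<exists>i. real a = theta_iter N i * real a')"
        using less.prems(3)
      proof
        assume *: "a * a + b * b < N * a * b"
        \<comment> \<open>By \<open>a' + b = N * a\<close>, both inequalities reduce to
          \<open>a * a < a' * b\<close>.\<close>
        have "N * a * b = a' * b + b * b" using a'_eq by (metis distrib_right)
        moreover have "N * a' * a = a' * a' + a' * b"
          using a'_eq by (metis distrib_left mult.assoc mult.commute)
        ultimately show ?thesis using * by simp
      next
        assume "\<exists>i. real b = theta_iter N i * real a"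
        then obtain i where i: "real b = theta_iter N i * real a" by blast
        show ?thesis
        proof (cases i)
          case 0
          then have "real b = real (N * a)" using i by simp
          then have "b = N * a" by (simp only: of_nat_eq_iff)
          then show ?thesis using a'_eq False by simp
        next
          case (Suc j)
          \<comment> \<open>Solving \<open>b / a = N - 1 / theta_iter N j\<close> gives
            \<open>a / a' = theta_iter N j\<close>: the reflection lowers the index by one.\<close>
          have "real a' + real b = real N * real a"
            using a'_eq by (metis of_nat_add of_nat_mult)
          then have "real a' = real a / theta_iter N j" using i Suc by (simp add: algebra_simps)
          then have "real a = theta_iter N j * real a'" using theta_iter_bounds[of N j] N by simp
          then show ?thesis by blast
        qed
      qed
      then have "filling_cert N a' (a - a')"
        using less.IH[of a' a] False a_eq by simp
      then show ?thesis using a_eq by simp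
    qed
    then have "filling_cert N a ((N - 2) * a + r)"
      using cert_reflection a_eq N less.prems(1) by auto
    then show ?thesis using b Na(2) by simp
  qed
qed

section \<open>Arithmetic of Psi_N and conclusion\<close>

text \<open>These are the values \<open>1 + 1 / (i + 1)\<close>, so that \<open>b - a\<close>
  divides \<open>a\<close>, the case in which two monomials suffice.\<close>

lemma theta_iter_2: "theta_iter 2 i = (real i + 2) / (real i + 1)"
proof (induction i)
  case (Suc i)
  show ?case unfolding theta_iter.simps Suc by (simp add: field_simps)
qed simp

text \<open>\<open>psi N\<close> is the larger root of \<open>x^2 - N x + 1\<close>, and the smaller
  root \<open>(N - s) / 2\<close> is at most 1, so \<open>\<alpha>\<close> lies strictly between the
  roots.\<close>

lemma less_psi_imp:
  assumes "2 \<le> N" "1 < \<alpha>" "\<alpha> < psi N"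
  shows "\<alpha>\<^sup>2 + 1 < real N * \<alpha>"
proof -
  define s where "s = sqrt ((real N)\<^sup>2 - 4)"
  have N4: "(real N)\<^sup>2 - 4 = (real N - 2) * (real N + 2)" by (simp add: power2_eq_square algebra_simps)
  have "(real N - 2)\<^sup>2 \<le> (real N)\<^sup>2 - 4"
    unfolding N4 power2_eq_square[of "real N - 2"] using assms(1) by (intro mult_left_mono) auto
  then have s_ge: "real N - 2 \<le> s"
    unfolding s_def by (rule real_le_rsqrt)
  have s2: "s\<^sup>2 = (real N)\<^sup>2 - 4"
    unfolding s_def N4 using assms(1) by (intro real_sqrt_pow2) auto
  have "0 < \<alpha> - (real N - s) / 2" using assms(2) s_ge by (simp add: field_simps)
  moreover have "\<alpha> - (real N + s) / 2 < 0" using assms(3) by (simp add: psi_def s_def)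
  ultimately have "(\<alpha> - (real N - s) / 2) * (\<alpha> - (real N + s) / 2) < 0"
    by (rule mult_pos_neg)
  also have "(\<alpha> - (real N - s) / 2) * (\<alpha> - (real N + s) / 2) = \<alpha>\<^sup>2 - real N * \<alpha> + ((real N)\<^sup>2 - s\<^sup>2) / 4"
    by (simp add: power2_eq_square field_simps)
  finally show ?thesis using s2 by simp
qed

theorem mainTheorem4:
  fixes N a b :: nat
  assumes "N \<ge> 2" and "a > 0" and "b > a" and "N \<le> b - a + 1"
    and "in_Psi N (real b / real a)"
  shows "general_subspace N (b - a)
           (\<lambda>V. \<forall>W. psubspace W \<and> W \<subseteq> S (a - 1) \<and> W \<noteq> {0} \<longrightarrow>
                  filling_ratio V W \<ge> real b / real a)"
proof -
  have low: "a * a + b * b < N * a * b" if "1 < real b / real a" "real b / real a < psi N"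
  proof -
    have "((real b / real a)\<^sup>2 + 1) * (real a)\<^sup>2 < real N * (real b / real a) * (real a)\<^sup>2"
      using less_psi_imp[OF assms(1) that] assms(2) by (intro mult_strict_right_mono) auto
    also have "((real b / real a)\<^sup>2 + 1) * (real a)\<^sup>2 = real (a * a + b * b)"
      using assms(2) by (simp add: power2_eq_square field_simps)
    also have "real N * (real b / real a) * (real a)\<^sup>2 = real (N * a * b)"
      using assms(2) by (simp add: power2_eq_square)
    finally have "real (a * a + b * b) < real (N * a * b)" .
    then show ?thesis by (simp only: of_nat_less_iff)
  qed
  have "filling_cert N a (b - a)"
  proof (cases "N = 2")
    case True
    \<comment> \<open>For \<open>N = 2\<close> the quadratic form is \<open>(a - b)^2\<close>, so
      the interval below \<open>psi\<close> is empty and \<open>b / a\<close> must be an iterate of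
      \<open>theta\<close>.\<close>
    have "\<not> a * a + b * b < 2 * a * b"
    proof
      assume "a * a + b * b < 2 * a * b"
      then have "int a * int a + int b * int b < 2 * int a * int b"
        by (metis of_nat_add of_nat_less_iff of_nat_mult of_nat_numeral)
      then show False using zero_le_square[of "int a - int b"] by (simp add: algebra_simps)
    qed
    then obtain i where "real b / real a = theta_iter 2 i"
      using low assms(5) True unfolding in_Psi_def by auto
    then have "real b * (real i + 1) = real a * (real i + 2)"
      using assms(2) by (simp add: theta_iter_2 field_simps)
    then have "real (b * (i + 1)) = real (a * (i + 2))" by (simp add: algebra_simps)
    then have "b * (i + 1) = a * (i + 2)" by (simp only: of_nat_eq_iff)
    then have "(b - a) * (i + 1) = a" by (simp add: algebra_simps diff_mult_distrib)
    then have "b - a dvd a" by (metis dvd_triv_left)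
    then show ?thesis using cert_low_slope[of "b - a" a N] True assms(2,3) dvd_imp_le by simp
  next
    case False
    have "a * a + b * b < N * a * b \<or> (\<exists>i. real b = theta_iter N i * real a)"
      using low assms(2,5) unfolding in_Psi_def by (auto simp: field_simps)
    then show ?thesis using False assms by (intro cert_Psi) auto
  qed
  then obtain f p q B where f: "\<forall>i<N. degree (f i) \<le> b - a"
    and q: "0 < q" "p * (a + (b - a)) \<le> q * a"
    and inj: "mult_inj N a f {..<p} {..<q} (B :: nat \<Rightarrow> nat \<Rightarrow> nat \<Rightarrow> complex)"
    unfolding filling_cert_def by blast
  have "general_subspace N (b - a) (\<lambda>V. \<forall>W. psubspace W \<and> W \<subseteq> S (a - 1) \<and> W \<noteq> {0} \<longrightarrow>
      real (a + (b - a)) / real a \<le> filling_ratio V W)"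
    using f q assms(4) by (intro general_subspace_filling_ratio[OF assms(2) _ inj]) auto
  then show ?thesis using assms(3) by simp
qed

end
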